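(* Let $f:\mathbb C\to\mathbb C$ be a scalar function with induced generalized tensor function $f^{\Diamond}$. Let $\mathbb T$ be one of the following classes of tensors: for one of the spaces $\mathbb K^{N\times1\times p}$, one of the tensors $\mathcal T\in\mathbb K^{N\times N\times p}$ and one of the form types listed here, bilinear forms: $(\mathbb R^{n\times1\times p},\mathcal I)$, $(\mathbb C^{n\times1\times p},\mathcal I)$, $(\mathbb R^{n\times1\times p},\Sigma_{a,b})$, $(\mathbb C^{n\times1\times p},\Sigma_{a,b})$, $(\mathbb R^{n\times1\times p},\mathcal R_n)$, $(\mathbb R^{2n\times1\times p},\mathcal J)$, $(\mathbb C^{2n\times1\times p},\mathcal J)$; sesquilinear forms: $(\mathbb C^{n\times1\times p},\mathcal I)$, $(\mathbb C^{n\times1\times p},\Sigma_{a,b})$, $(\mathbb C^{n\times1\times p},\mathcal R_n)$, $(\mathbb C^{2n\times1\times p},\mathcal J)$; $\mathbb T$ is either the Jordan algebra $\mathbb J=\{\mathcal S\in\mathbb K^{N\times N\times p}:\mathcal S^\star=\mathcal S\}$ or the Lie algebra $\mathbb L=\{\mathcal L\in\mathbb K^{N\times N\times p}:\mathcal L^\star=-\mathcal L\}$. If $\mathcal A\in\mathbb T$ and $f^{\Diamond}(\mathcal A)$ is well defined, then $f^{\Diamond}(\mathcal A)\in\mathbb T$.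
   Context: T-product. For $\mathcal A\in\mathbb C^{m\times n\times p}$ with frontal slices $A^{(1)},\dots,A^{(p)}\in\mathbb C^{m\times n}$, $\mathrm{unfold}(\mathcal A)\in\mathbb C^{mp\times n}$ is the vertical stack of $A^{(1)},\dots,A^{(p)}$, $\mathrm{fold}$ is its inverse, and $\mathrm{bcirc}(\mathcal A)\in\mathbb C^{mp\times np}$ is the block circulant matrix whose $(a,b)$ block is $A^{(((a-b)\bmod p)+1)}$; $\mathrm{bcirc}^{-1}$ is the inverse of $\mathrm{bcirc}$ on its image. For $\mathcal B\in\mathbb C^{n\times s\times p}$, $\mathcal A*\mathcal B=\mathrm{fold}(\mathrm{bcirc}(\mathcal A)\,\mathrm{unfold}(\mathcal B))$. $\mathcal A^\top$ (resp. $\mathcal A^H$) is obtained by transposing (resp. conjugate transposing) each frontal slice and reversing the order of slices $2,\dots,p$. The identity tensor $\mathcal I=\mathcal I_{nnp}$ has first frontal slice $I_n$ and other slices zero; inverses and unitary tensors ($\mathcal Q^H*\mathcal Q=\mathcal Q*\mathcal Q^H=\mathcal I$) are with respect to $*$. Generalized tensor function. $F_p=p^{-1/2}(\omega^{jk})_{j,k=0}^{p-1}$ with $\omega=e^{-2\pi\mathbf i/p}$. A T-SVD is $\mathcal A=\mathcal U*\mathcal S*\mathcal V^H$ with $\mathcal U,\mathcal V$ unitary, $\mathcal S$ F-diagonal (every frontal slice diagonal) and $\mathrm{bcirc}(\mathcal S)=(F_p\otimes I_m)\mathrm{diag}(\Sigma_1,\dots,\Sigma_p)(F_p^H\otimes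 I_n)$, where each $\Sigma_i\in\mathbb R^{m\times n}$ is diagonal with nonnegative entries. For a scalar function $f$, $f^{\Diamond}(\mathcal A)=\mathcal U*\hat f(\mathcal S)*\mathcal V^H$ with $\hat f(\mathcal S)=\mathrm{bcirc}^{-1}\big((F_p\otimes I_m)\mathrm{diag}(\tilde f(\Sigma_1),\dots,\tilde f(\Sigma_p))(F_p^H\otimes I_n)\big)$ and $\tilde f(\Sigma_i)=f(\sqrt{\Sigma_i\Sigma_i^H})(\sqrt{\Sigma_i\Sigma_i^H})^\dagger\Sigma_i$, i.e. $\tilde f(\Sigma_i)$ is diagonal, with $f(\sigma)$ in place of each diagonal entry $\sigma>0$ and $0$ in place of each diagonal entry $0$. Special tensors and adjoint. $\mathcal R_n\in\mathbb R^{n\times n\times p}$ has first frontal slice the $n\times n$ matrix with ones on the antidiagonal and zeros elsewhere, and other slices zero. $\mathcal J=\begin{bmatrix}0&\mathcal I_{nnp}\\-\mathcal I_{nnp}&0\end{bmatrix}\in\mathbb R^{2n\times2n\times p}$ and $\Sigma_{a,b}=\begin{bmatrix}\mathcal I_{aap}&0\\0&-\mathcal I_{bbp}\end{bmatrix}\in\mathbb R^{n\times n\times p}$ with $a+b=n$ (block tensors are formed slice by slice from the frontal slices). The scalar product is $\langle x,y\rangle_{\mathcal T}=x^\top*\mathcal T*y$ for bilinear forms and $x^H*\mathcal T*y$ for sesquilinear forms, and the adjoint is $\mathcal A^\star=\mathcal T^{-1}*\mathcal A^\top*\mathcal T$ for bilinear forms and $\mathcal A^\star=\mathcal T^{-1}*\mathcal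 A^H*\mathcal T$ for sesquilinear forms.
   Formalization: For real spaces and for sesquilinear forms, f is additionally assumed to take real values at the positive singular values of A; without this the claim fails (n=p=1, T=I, A=1, f(1)=i), and the condition is also necessary there. *)

theory Defs
  imports Complex_Main "Jordan_Normal_Form.Matrix" "Jordan_Normal_Form.Schur_Decomposition"
begin

text \<open>An \<open>m \<times> n \<times> p\<close> tensor is the list of its \<open>p\<close> frontal slices. All indices start at 0, and
  \<open>p \<ge> 1\<close> is intended throughout. A tensor over the reals is a tensor whose entries lie in \<open>\<real>\<close>.\<close>

type_synonym tensor = "complex mat list"

definition tensor_over :: "complex set \<Rightarrow> nat \<Rightarrow> nat \<Rightarrow> nat \<Rightarrow> tensor set" where
  "tensor_over K m n p =
     {A. length A = p \<and> (\<forall>X \<in> set A. X \<in> carrier_mat m n \<and> elements_mat X \<subseteq> K)}"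

abbreviation tensors :: "nat \<Rightarrow> nat \<Rightarrow> nat \<Rightarrow> tensor set" where
  "tensors \<equiv> tensor_over UNIV"

definition trows :: "tensor \<Rightarrow> nat" where
  "trows A = dim_row (hd A)"

definition tcols :: "tensor \<Rightarrow> nat" where
  "tcols A = dim_col (hd A)"


subsection \<open>The T-product\<close>

definition unfold_tensor :: "tensor \<Rightarrow> complex mat" where
  "unfold_tensor A = (let m = trows A; n = tcols A; p = length A in
     mat (m * p) n (\<lambda>(i, j). (A ! (i div m)) $$ (i mod m, j)))"

definition fold_tensor :: "nat \<Rightarrow> nat \<Rightarrow> complex mat \<Rightarrow> tensor" where
  "fold_tensor m p M =
     map (\<lambda>k. mat m (dim_col M) (\<lambda>(i, j). M $$ (k * m + i, j))) [0..<p]"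

text \<open>Adding \<open>p\<close> before subtracting avoids truncated subtraction on the naturals.\<close>

definition bcirc :: "tensor \<Rightarrow> complex mat" where
  "bcirc A = (let m = trows A; n = tcols A; p = length A in
     mat (m * p) (n * p) (\<lambda>(i, j).
       (A ! ((p + i div m - j div n) mod p)) $$ (i mod m, j mod n)))"

definition bcirc_inv :: "nat \<Rightarrow> nat \<Rightarrow> nat \<Rightarrow> complex mat \<Rightarrow> tensor" where
  "bcirc_inv m n p = the_inv_into (tensors m n p) bcirc"

definition t_prod :: "tensor \<Rightarrow> tensor \<Rightarrow> tensor"  (infixl "\<star>\<^sub>T" 70) where
  "A \<star>\<^sub>T B = fold_tensor (trows A) (length A) (bcirc A * unfold_tensor B)"

definition t_transpose :: "tensor \<Rightarrow> tensor" where
  "t_transpose A = (let p = length A in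
     map (\<lambda>k. transpose_mat (A ! ((p - k) mod p))) [0..<p])"

definition t_adjoint :: "tensor \<Rightarrow> tensor" where
  "t_adjoint A = (let p = length A in
     map (\<lambda>k. mat_adjoint (A ! ((p - k) mod p))) [0..<p])"

definition t_uminus :: "tensor \<Rightarrow> tensor" where
  "t_uminus A = map uminus A"

definition t_zero :: "nat \<Rightarrow> nat \<Rightarrow> nat \<Rightarrow> tensor" where
  "t_zero m n p = replicate p (0\<^sub>m m n)"

definition first_slice :: "nat \<Rightarrow> complex mat \<Rightarrow> tensor" where
  "first_slice p M = M # replicate (p - 1) (0\<^sub>m (dim_row M) (dim_col M))"

definition t_id :: "nat \<Rightarrow> nat \<Rightarrow> tensor" where
  "t_id n p = first_slice p (1\<^sub>m n)"

definition t_inverse :: "tensor \<Rightarrow> tensor" where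
  "t_inverse A = (let n = trows A; p = length A in
     THE X. X \<in> tensors n n p \<and> A \<star>\<^sub>T X = t_id n p \<and> X \<star>\<^sub>T A = t_id n p)"

definition t_unitary :: "nat \<Rightarrow> nat \<Rightarrow> tensor \<Rightarrow> bool" where
  "t_unitary n p Q \<longleftrightarrow> Q \<in> tensors n n p \<and>
     t_adjoint Q \<star>\<^sub>T Q = t_id n p \<and> Q \<star>\<^sub>T t_adjoint Q = t_id n p"


subsection \<open>T-SVD and generalized tensor functions\<close>

definition kronecker :: "complex mat \<Rightarrow> complex mat \<Rightarrow> complex mat"  (infixl "\<otimes>\<^sub>K" 70) where
  "A \<otimes>\<^sub>K B = mat (dim_row A * dim_row B) (dim_col A * dim_col B) (\<lambda>(i, j).
     A $$ (i div dim_row B, j div dim_col B) * B $$ (i mod dim_row B, j mod dim_col B))"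

definition fourier_mat :: "nat \<Rightarrow> complex mat" where
  "fourier_mat p = mat p p (\<lambda>(j, k).
     complex_of_real (1 / sqrt (real p)) * exp (- 2 * pi * \<i> / of_nat p) ^ (j * k))"

definition block_circulant :: "nat \<Rightarrow> nat \<Rightarrow> nat \<Rightarrow> complex mat list \<Rightarrow> complex mat" where
  "block_circulant m n p Ds =
     (fourier_mat p \<otimes>\<^sub>K 1\<^sub>m m) * diag_block_mat Ds * (mat_adjoint (fourier_mat p) \<otimes>\<^sub>K 1\<^sub>m n)"

definition F_diagonal :: "tensor \<Rightarrow> bool" where
  "F_diagonal S \<longleftrightarrow> (\<forall>X \<in> set S. diagonal_mat X)"

text \<open>\<open>Sig\<close> lists the real diagonal blocks \<open>\<Sigma>\<^sub>1, \<dots>, \<Sigma>\<^sub>p\<close>; their diagonal entries need not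
  be sorted.\<close>

definition t_svd :: "tensor \<Rightarrow> tensor \<Rightarrow> tensor \<Rightarrow> tensor \<Rightarrow> real mat list \<Rightarrow> bool" where
  "t_svd A U S V Sig \<longleftrightarrow> (let m = trows A; n = tcols A; p = length A in
     t_unitary m p U \<and> t_unitary n p V \<and> S \<in> tensors m n p \<and> F_diagonal S \<and>
     length Sig = p \<and>
     (\<forall>D \<in> set Sig. D \<in> carrier_mat m n \<and> diagonal_mat D \<and> (\<forall>x \<in> elements_mat D. 0 \<le> x)) \<and>
     bcirc S = block_circulant m n p (map (map_mat complex_of_real) Sig) \<and>
     A = U \<star>\<^sub>T S \<star>\<^sub>T t_adjoint V)"

definition f_tilde :: "(complex \<Rightarrow> complex) \<Rightarrow> real mat \<Rightarrow> complex mat" where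
  "f_tilde f D = mat (dim_row D) (dim_col D) (\<lambda>(i, j).
     if i = j \<and> 0 < D $$ (i, i) then f (complex_of_real (D $$ (i, i))) else 0)"

definition f_hat :: "(complex \<Rightarrow> complex) \<Rightarrow> nat \<Rightarrow> nat \<Rightarrow> nat \<Rightarrow> real mat list \<Rightarrow> tensor" where
  "f_hat f m n p Sig = bcirc_inv m n p (block_circulant m n p (map (f_tilde f) Sig))"

text \<open>\<open>gtf_value f A B\<close>: some T-SVD of \<open>A\<close> produces \<open>B\<close>. The generalized function is well
  defined at \<open>A\<close> if a T-SVD exists and all T-SVDs of \<open>A\<close> produce the same tensor.\<close>

definition gtf_value :: "(complex \<Rightarrow> complex) \<Rightarrow> tensor \<Rightarrow> tensor \<Rightarrow> bool" where
  "gtf_value f A B \<longleftrightarrow> (\<exists>U S V Sig. t_svd A U S V Sig \<and>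
     B = U \<star>\<^sub>T f_hat f (trows A) (tcols A) (length A) Sig \<star>\<^sub>T t_adjoint V)"

definition gtf_well_defined :: "(complex \<Rightarrow> complex) \<Rightarrow> tensor \<Rightarrow> bool" where
  "gtf_well_defined f A \<longleftrightarrow> (\<exists>!B. gtf_value f A B)"

definition gtf :: "(complex \<Rightarrow> complex) \<Rightarrow> tensor \<Rightarrow> tensor" where
  "gtf f A = (THE B. gtf_value f A B)"

definition pos_singular_values :: "tensor \<Rightarrow> real set" where
  "pos_singular_values A = {\<sigma>. 0 < \<sigma> \<and>
     (\<exists>U S V Sig. t_svd A U S V Sig \<and> (\<exists>D \<in> set Sig. \<sigma> \<in> elements_mat D))}"


subsection \<open>Scalar products, Jordan and Lie algebras\<close>

definition t_block :: "tensor \<Rightarrow> tensor \<Rightarrow> tensor \<Rightarrow> tensor \<Rightarrow> tensor" where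
  "t_block A B C D =
     map (\<lambda>k. four_block_mat (A ! k) (B ! k) (C ! k) (D ! k)) [0..<length A]"

definition R_tensor :: "nat \<Rightarrow> nat \<Rightarrow> tensor" where
  "R_tensor n p = first_slice p (mat n n (\<lambda>(i, j). if i + j + 1 = n then 1 else 0))"

definition J_tensor :: "nat \<Rightarrow> nat \<Rightarrow> tensor" where
  "J_tensor n p = t_block (t_zero n n p) (t_id n p) (t_uminus (t_id n p)) (t_zero n n p)"

definition Sigma_tensor :: "nat \<Rightarrow> nat \<Rightarrow> nat \<Rightarrow> tensor" where
  "Sigma_tensor a b p = t_block (t_id a p) (t_zero a b p) (t_zero b a p) (t_uminus (t_id b p))"

datatype form_type = Bilinear | Sesquilinear

fun t_star :: "form_type \<Rightarrow> tensor \<Rightarrow> tensor \<Rightarrow> tensor" where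
  "t_star Bilinear T A = t_inverse T \<star>\<^sub>T t_transpose A \<star>\<^sub>T T"
| "t_star Sesquilinear T A = t_inverse T \<star>\<^sub>T t_adjoint A \<star>\<^sub>T T"

definition jordan_algebra :: "complex set \<Rightarrow> form_type \<Rightarrow> nat \<Rightarrow> nat \<Rightarrow> tensor \<Rightarrow> tensor set" where
  "jordan_algebra K form N p T = {S \<in> tensor_over K N N p. t_star form T S = S}"

definition lie_algebra :: "complex set \<Rightarrow> form_type \<Rightarrow> nat \<Rightarrow> nat \<Rightarrow> tensor \<Rightarrow> tensor set" where
  "lie_algebra K form N p T = {L \<in> tensor_over K N N p. t_star form T L = t_uminus L}"

text \<open>\<open>listed_space K form N p T\<close>: the space \<open>K\<^sup>N\<^sup>\<times>\<^sup>1\<^sup>\<times>\<^sup>p\<close> with the form of the given type induced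
  by \<open>T\<close> is one of the scalar product spaces under consideration; \<open>K\<close> is \<open>\<real>\<close> or \<open>UNIV\<close>.\<close>

inductive listed_space :: "complex set \<Rightarrow> form_type \<Rightarrow> nat \<Rightarrow> nat \<Rightarrow> tensor \<Rightarrow> bool" where
  bil_id_real: "n \<ge> 1 \<Longrightarrow> p \<ge> 1 \<Longrightarrow> listed_space \<real> Bilinear n p (t_id n p)"
| bil_id_complex: "n \<ge> 1 \<Longrightarrow> p \<ge> 1 \<Longrightarrow> listed_space UNIV Bilinear n p (t_id n p)"
| bil_Sigma_real: "n \<ge> 1 \<Longrightarrow> p \<ge> 1 \<Longrightarrow> a + b = n \<Longrightarrow>
    listed_space \<real> Bilinear n p (Sigma_tensor a b p)"
| bil_Sigma_complex: "n \<ge> 1 \<Longrightarrow> p \<ge> 1 \<Longrightarrow> a + b = n \<Longrightarrow>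
    listed_space UNIV Bilinear n p (Sigma_tensor a b p)"
| bil_R_real: "n \<ge> 1 \<Longrightarrow> p \<ge> 1 \<Longrightarrow> listed_space \<real> Bilinear n p (R_tensor n p)"
| bil_J_real: "n \<ge> 1 \<Longrightarrow> p \<ge> 1 \<Longrightarrow> listed_space \<real> Bilinear (2 * n) p (J_tensor n p)"
| bil_J_complex: "n \<ge> 1 \<Longrightarrow> p \<ge> 1 \<Longrightarrow> listed_space UNIV Bilinear (2 * n) p (J_tensor n p)"
| ses_id: "n \<ge> 1 \<Longrightarrow> p \<ge> 1 \<Longrightarrow> listed_space UNIV Sesquilinear n p (t_id n p)"
| ses_Sigma: "n \<ge> 1 \<Longrightarrow> p \<ge> 1 \<Longrightarrow> a + b = n \<Longrightarrow>
    listed_space UNIV Sesquilinear n p (Sigma_tensor a b p)"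
| ses_R: "n \<ge> 1 \<Longrightarrow> p \<ge> 1 \<Longrightarrow> listed_space UNIV Sesquilinear n p (R_tensor n p)"
| ses_J: "n \<ge> 1 \<Longrightarrow> p \<ge> 1 \<Longrightarrow> listed_space UNIV Sesquilinear (2 * n) p (J_tensor n p)"

end

theory Submission
  imports Defs
begin

text \<open>
  The map \<open>bcirc\<close> is an injective homomorphism of algebras compatible with transposition and
  conjugation, and a matrix \<open>(F\<^sub>p \<otimes> I) diag(D\<^sub>1, \<dots>, D\<^sub>p) (F\<^sub>p\<^sup>H \<otimes> I)\<close> is the image of the tensor whose
  slices are the discrete Fourier transform of the \<open>D\<^sub>i\<close>. Hence a T-SVD of \<open>A\<close> yields T-SVDs of
  \<open>P * A * Q\<^sup>H\<close> (with \<open>P\<close>, \<open>Q\<close> unitary), of \<open>-A\<close>, of \<open>A\<^sup>\<top>\<close> and of the conjugate of \<open>A\<close>; the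
  generalized function value transforms in the same way, except that conjugation also conjugates \<open>f\<close>.
  Every listed \<open>T\<close> is unitary, so the adjoint of \<open>A\<close> is \<open>T\<^sup>H * A\<^sup>\<top> * (T\<^sup>H)\<^sup>H\<close> or
  \<open>T\<^sup>H * A\<^sup>H * (T\<^sup>H)\<^sup>H\<close>, and its generalized function value is the adjoint of that of \<open>A\<close>.
  When the adjoint of \<open>A\<close> is \<open>\<plusminus>A\<close>, uniqueness of the value finishes the proof. Realness of \<open>f\<close> on the
  singular values is what removes the conjugation of \<open>f\<close> in the real and the sesquilinear case.
\<close>

subsection \<open>Entrywise description of the tensor operations\<close>

lemma mat_adjoint_carrier [simp]:
  "mat_adjoint A \<in> carrier_mat (dim_col A) (dim_row A)"
  "dim_row (mat_adjoint A) = dim_col A" "dim_col (mat_adjoint A) = dim_row A"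
  unfolding mat_adjoint_def by auto

lemma index_mat_adjoint [simp]:
  fixes A :: "complex mat"
  assumes "i < dim_col A" "j < dim_row A"
  shows "mat_adjoint A $$ (i, j) = cnj (A $$ (j, i))"
  using assms unfolding mat_adjoint_def by (simp add: mat_of_rows_index)

lemma tensors_iff:
  "A \<in> tensors m n p \<longleftrightarrow> length A = p \<and> (\<forall>k<p. A ! k \<in> carrier_mat m n)"
  unfolding tensor_over_def by (auto simp: all_set_conv_all_nth)

lemma tensors_length: "A \<in> tensors m n p \<Longrightarrow> length A = p"
  by (simp add: tensors_iff)

lemma tensors_nth: "A \<in> tensors m n p \<Longrightarrow> k < p \<Longrightarrow> A ! k \<in> carrier_mat m n"
  by (simp add: tensors_iff)

lemma tensors_nth_dim:
  assumes "A \<in> tensors m n p" "k < p"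
  shows "dim_row (A ! k) = m" "dim_col (A ! k) = n"
  using tensors_nth[OF assms] by auto

lemma trows_eq: "A \<in> tensors m n p \<Longrightarrow> 0 < p \<Longrightarrow> trows A = m"
  unfolding trows_def by (metis tensors_nth_dim(1) tensors_length hd_conv_nth length_greater_0_conv)

lemma tcols_eq: "A \<in> tensors m n p \<Longrightarrow> 0 < p \<Longrightarrow> tcols A = n"
  unfolding tcols_def by (metis tensors_nth_dim(2) tensors_length hd_conv_nth length_greater_0_conv)

lemma tensor_eqI:
  assumes "A \<in> tensors m n p" "B \<in> tensors m n p"
    and "\<And>k i j. k < p \<Longrightarrow> i < m \<Longrightarrow> j < n \<Longrightarrow> A ! k $$ (i, j) = B ! k $$ (i, j)"
  shows "A = B"
proof (rule nth_equalityI)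
  show "length A = length B" using assms(1,2) by (simp add: tensors_iff)
  fix k assume "k < length A"
  then have k: "k < p" using assms(1) by (simp add: tensors_iff)
  show "A ! k = B ! k"
    using assms(3)[OF k] tensors_nth_dim[OF assms(1) k] tensors_nth_dim[OF assms(2) k]
    by (intro eq_matI) auto
qed

text \<open>Conjugation is kept apart from transposition, with the adjoint as their composition:
  bilinear forms need the transpose alone, and real tensors are handled by conjugation
  alone.\<close>

definition t_conj :: "tensor \<Rightarrow> tensor" where
  "t_conj A = map (map_mat cnj) A"

lemma t_conj_tensors: "A \<in> tensors m n p \<Longrightarrow> t_conj A \<in> tensors m n p"
  by (auto simp: tensors_iff t_conj_def)

lemma t_conj_nth:
  assumes "A \<in> tensors m n p" "k < p" "i < m" "j < n"
  shows "t_conj A ! k $$ (i, j) = cnj (A ! k $$ (i, j))"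
  using assms tensors_nth_dim[OF assms(1,2)] by (simp add: t_conj_def tensors_length)

lemma t_uminus_tensors: "A \<in> tensors m n p \<Longrightarrow> t_uminus A \<in> tensors m n p"
  by (auto simp: tensors_iff t_uminus_def)

lemma t_uminus_nth:
  assumes "A \<in> tensors m n p" "k < p" "i < m" "j < n"
  shows "t_uminus A ! k $$ (i, j) = - (A ! k $$ (i, j))"
  using assms tensors_nth_dim[OF assms(1,2)] by (simp add: t_uminus_def tensors_length)

lemma t_uminus_uminus: "A \<in> tensors m n p \<Longrightarrow> t_uminus (t_uminus A) = A"
  by (rule tensor_eqI) (auto simp: t_uminus_tensors t_uminus_nth[of _ m n p])

lemma t_transpose_tensors: "A \<in> tensors m n p \<Longrightarrow> t_transpose A \<in> tensors n m p"
  by (auto simp: tensors_iff t_transpose_def Let_def)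

lemma t_transpose_nth:
  assumes "A \<in> tensors m n p" "k < p" "i < n" "j < m"
  shows "t_transpose A ! k $$ (i, j) = A ! ((p - k) mod p) $$ (j, i)"
  using assms tensors_nth_dim[OF assms(1), of "(p - k) mod p"]
  by (simp add: t_transpose_def Let_def tensors_length)

lemma t_adjoint_eq:
  assumes "A \<in> tensors m n p"
  shows "t_adjoint A = t_conj (t_transpose A)"
proof -
  have "mat_adjoint X = map_mat cnj (transpose_mat X)" for X :: "complex mat"
    by (intro eq_matI) auto
  then show ?thesis by (simp add: t_adjoint_def t_transpose_def t_conj_def Let_def)
qed

lemma t_adjoint_tensors: "A \<in> tensors m n p \<Longrightarrow> t_adjoint A \<in> tensors n m p"
  by (simp add: t_adjoint_eq t_conj_tensors t_transpose_tensors)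

lemma t_conj_conj: "A \<in> tensors m n p \<Longrightarrow> t_conj (t_conj A) = A"
  by (rule tensor_eqI) (auto simp: t_conj_tensors t_conj_nth[of _ m n p])

lemma t_transpose_transpose:
  assumes A: "A \<in> tensors m n p"
  shows "t_transpose (t_transpose A) = A"
proof (rule tensor_eqI[OF _ A])
  show "t_transpose (t_transpose A) \<in> tensors m n p" by (intro t_transpose_tensors A)
  fix k i j assume "k < p" "i < m" "j < n"
  \<comment> \<open>Negation modulo \<open>p\<close> is an involution; index 0 is a separate case
    because there the inner \<open>mod\<close> wraps \<open>p\<close> to 0.\<close>
  moreover have "(p - (p - k) mod p) mod p = k" if "k < p"
    using that by (cases "k = 0") auto
  ultimately show "t_transpose (t_transpose A) ! k $$ (i, j) = A ! k $$ (i, j)"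
    by (simp add: t_transpose_nth[OF t_transpose_tensors[OF A]] t_transpose_nth[OF A])
qed

lemma t_transpose_conj:
  assumes A: "A \<in> tensors m n p"
  shows "t_transpose (t_conj A) = t_conj (t_transpose A)"
  by (rule tensor_eqI[of _ n m p])
     (auto simp: t_conj_tensors t_transpose_tensors A
       t_transpose_nth[OF t_conj_tensors[OF A]] t_conj_nth[OF t_transpose_tensors[OF A]]
       t_transpose_nth[OF A] t_conj_nth[OF A])

lemma t_transpose_uminus:
  assumes A: "A \<in> tensors m n p"
  shows "t_transpose (t_uminus A) = t_uminus (t_transpose A)"
  by (rule tensor_eqI[of _ n m p])
     (auto simp: t_uminus_tensors t_transpose_tensors A
       t_transpose_nth[OF t_uminus_tensors[OF A]] t_uminus_nth[OF t_transpose_tensors[OF A]]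
       t_transpose_nth[OF A] t_uminus_nth[OF A])

lemma t_conj_uminus:
  assumes A: "A \<in> tensors m n p"
  shows "t_conj (t_uminus A) = t_uminus (t_conj A)"
  by (rule tensor_eqI[of _ m n p])
     (auto simp: t_uminus_tensors t_conj_tensors A
       t_conj_nth[OF t_uminus_tensors[OF A]] t_uminus_nth[OF t_conj_tensors[OF A]]
       t_conj_nth[OF A] t_uminus_nth[OF A])

lemma t_adjoint_uminus:
  assumes A: "A \<in> tensors m n p"
  shows "t_adjoint (t_uminus A) = t_uminus (t_adjoint A)"
  by (simp add: t_adjoint_eq[OF A] t_adjoint_eq[OF t_uminus_tensors[OF A]]
      t_transpose_uminus[OF A] t_conj_uminus[OF t_transpose_tensors[OF A]])

lemma t_adjoint_adjoint:
  assumes A: "A \<in> tensors m n p"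
  shows "t_adjoint (t_adjoint A) = A"
proof -
  have "t_adjoint (t_adjoint A) = t_conj (t_conj (t_transpose (t_transpose A)))"
    using t_transpose_conj[OF t_transpose_tensors[OF A]]
    by (simp add: t_adjoint_eq[OF t_conj_tensors[OF t_transpose_tensors[OF A]]] t_adjoint_eq[OF A])
  then show ?thesis by (simp add: t_transpose_transpose[OF A] t_conj_conj[OF A])
qed

lemma first_slice_tensors:
  "M \<in> carrier_mat m n \<Longrightarrow> 0 < p \<Longrightarrow> first_slice p M \<in> tensors m n p"
  by (auto simp: tensors_iff first_slice_def nth_Cons split: nat.splits)

lemma first_slice_nth:
  assumes "M \<in> carrier_mat m n" "k < p" "i < m" "j < n"
  shows "first_slice p M ! k $$ (i, j) = (if k = 0 then M $$ (i, j) else 0)"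
  using assms by (auto simp: first_slice_def nth_Cons split: nat.splits)

lemma t_id_tensors: "0 < p \<Longrightarrow> t_id n p \<in> tensors n n p"
  by (simp add: t_id_def first_slice_tensors)

subsection \<open>Block circulant matrices\<close>

lemma div_mod_less:
  fixes i m p :: nat
  assumes "i < m * p"
  shows "i div m < p" "i mod m < m"
  using assms by (simp_all add: less_mult_imp_div_less mult.commute)
    (metis mod_less_divisor mult_0 not_gr_zero not_less_zero)

text \<open>Over the integers subtraction is not truncated, so identities between block indices
  become congruences; \<open>b < p\<close> keeps \<open>p + a - b\<close> exact.\<close>

lemma int_mod_diff:
  fixes a b p :: nat
  assumes "b < p"
  shows "int ((p + a - b) mod p) = (int a - int b) mod int p"
proof -
  have "int (p + a - b) = int p + (int a - int b)" using assms by simp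
  then show ?thesis by (simp add: zmod_int)
qed

text \<open>Arithmetic of Z/p for block indices: the first two laws make a shift by \<open>b\<close>
  a bijection, the third serves products of circulants, the fourth transposition, the last the
  identity.\<close>

lemma mod_diff_simps:
  fixes a b d p :: nat
  assumes "a < p" "b < p" "d < p"
  shows mod_diff_add: "((p + d - b) mod p + b) mod p = d"
    and mod_add_diff: "(p + (d + b) mod p - b) mod p = d"
    and mod_diff_diff: "(p + (p + a - b) mod p - (p + d - b) mod p) mod p = (p + a - d) mod p"
    and mod_uminus_diff: "(p - (p + a - b) mod p) mod p = (p + b - a) mod p"
    and mod_diff_eq_0_iff: "(p + a - b) mod p = 0 \<longleftrightarrow> a = b"
proof -
  have p: "(p + x) mod p < p" "x mod p < p" for x using assms by auto
  have "int (((p + d - b) mod p + b) mod p) = int d"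
    using assms by (simp add: zmod_int[of "_ + b"] int_mod_diff mod_add_left_eq)
  then show "((p + d - b) mod p + b) mod p = d" by (simp only: of_nat_eq_iff)
  have "int ((p + (d + b) mod p - b) mod p) = int d"
    using assms by (simp add: int_mod_diff zmod_int[of "d + b"] mod_diff_left_eq)
  then show "(p + (d + b) mod p - b) mod p = d" by (simp only: of_nat_eq_iff)
  have "int ((p + (p + a - b) mod p - (p + d - b) mod p) mod p) = int ((p + a - d) mod p)"
    using assms by (simp add: int_mod_diff mod_diff_eq)
  then show "(p + (p + a - b) mod p - (p + d - b) mod p) mod p = (p + a - d) mod p"
    by (simp only: of_nat_eq_iff)
  have "int ((p - (p + a - b) mod p) mod p) = int ((p + b - a) mod p)"
    using assms int_mod_diff[of "(p + a - b) mod p" p 0]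
    by (simp add: int_mod_diff mod_minus_eq)
  then show "(p - (p + a - b) mod p) mod p = (p + b - a) mod p" by (simp only: of_nat_eq_iff)
  show "(p + a - b) mod p = 0 \<longleftrightarrow> a = b"
  proof (cases "b \<le> a")
    case True
    then have "(p + a - b) mod p = (p + (a - b)) mod p" by simp
    also have "\<dots> = (a - b) mod p" by (rule mod_add_self1)
    finally have "(p + a - b) mod p = a - b" using assms by simp
    then show ?thesis using True by simp
  next
    \<comment> \<open>Here \<open>0 < p + a - b < p\<close>, so reduction changes nothing and the
      residue is nonzero.\<close>
    case False
    then show ?thesis using assms by simp
  qed
qed

text \<open>The range of summation splits into \<open>p\<close> consecutive blocks of length
  \<open>n\<close>, with \<open>l = d * n + t\<close> in block \<open>d\<close> at offset
  \<open>t\<close>.\<close>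

lemma sum_div_mod:
  fixes g :: "nat \<Rightarrow> nat \<Rightarrow> 'a::comm_monoid_add"
  shows "(\<Sum>l<n * p. g (l div n) (l mod n)) = (\<Sum>d<p. \<Sum>t<n. g d t)"
proof -
  have "(\<Sum>l<n * p. g (l div n) (l mod n))
      = (\<Sum>d<p. \<Sum>l\<in>{d * n..<d * n + n}. g (l div n) (l mod n))"
    by (simp add: sum.nat_group mult.commute)
  also have "\<dots> = (\<Sum>d<p. \<Sum>t<n. g d t)"
  proof (rule sum.cong[OF refl])
    fix d
    have block: "l div n = d" "l mod n = l - d * n" if "d * n \<le> l" "l < d * n + n" for l
    proof -
      show *: "l div n = d" using that by (intro div_nat_eqI) (auto simp: algebra_simps)
      show "l mod n = l - d * n" using * by (simp add: modulo_nat_def)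
    qed
    show "(\<Sum>l\<in>{d * n..<d * n + n}. g (l div n) (l mod n)) = (\<Sum>t<n. g d t)"
      by (rule sum.reindex_bij_witness[of _ "\<lambda>t. d * n + t" "\<lambda>l. l - d * n"])
         (use block in auto)
  qed
  finally show ?thesis .
qed

lemma index_mult_block:
  fixes M N :: "complex mat"
  assumes "M \<in> carrier_mat r (n * p)" "N \<in> carrier_mat (n * p) c" "x < r" "y < c"
  shows "(M * N) $$ (x, y) = (\<Sum>d<p. \<Sum>t<n. M $$ (x, d * n + t) * N $$ (d * n + t, y))"
  using sum_div_mod[of "\<lambda>d t. M $$ (x, d * n + t) * N $$ (d * n + t, y)" n p] assms
  by (simp add: scalar_prod_def lessThan_atLeast0)

lemma bcirc_carrier:
  "A \<in> tensors m n p \<Longrightarrow> 0 < p \<Longrightarrow> bcirc A \<in> carrier_mat (m * p) (n * p)"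
  by (simp add: bcirc_def Let_def trows_eq tcols_eq tensors_length)

lemma bcirc_index:
  assumes "A \<in> tensors m n p" "0 < p" "i < m * p" "j < n * p"
  shows "bcirc A $$ (i, j) = A ! ((p + i div m - j div n) mod p) $$ (i mod m, j mod n)"
  using assms by (simp add: bcirc_def Let_def trows_eq tcols_eq tensors_length)

text \<open>Block number and offset replace \<open>div\<close> and \<open>mod\<close>, so that later
  identities are checked block by block.\<close>

lemma bcirc_eqI:
  assumes A: "A \<in> tensors m n p" and p: "0 < p" and M: "M \<in> carrier_mat (m * p) (n * p)"
    and eq: "\<And>a b i j. a < p \<Longrightarrow> b < p \<Longrightarrow> i < m \<Longrightarrow> j < n \<Longrightarrow>
      A ! ((p + a - b) mod p) $$ (i, j) = M $$ (a * m + i, b * n + j)"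
  shows "bcirc A = M"
proof (rule eq_matI)
  show "dim_row (bcirc A) = dim_row M" "dim_col (bcirc A) = dim_col M"
    using bcirc_carrier[OF A p] M by auto
  fix i j assume "i < dim_row M" "j < dim_col M"
  then have ij: "i < m * p" "j < n * p" using M by auto
  show "bcirc A $$ (i, j) = M $$ (i, j)"
    using bcirc_index[OF A p ij] eq[of "i div m" "j div n" "i mod m" "j mod n"]
      div_mod_less[OF ij(1)] div_mod_less[OF ij(2)] by simp
qed

lemma block_index_less:
  fixes a i m p :: nat
  assumes "a < p" "i < m"
  shows "a * m + i < m * p"
proof -
  have "a * m + i < (a + 1) * m" using assms by simp
  also have "\<dots> \<le> p * m" using assms by (intro mult_right_mono) auto
  finally show ?thesis by (simp add: mult.commute)
qed

lemma bcirc_block: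
  assumes "A \<in> tensors m n p" "a < p" "b < p" "i < m" "j < n"
  shows "bcirc A $$ (a * m + i, b * n + j) = A ! ((p + a - b) mod p) $$ (i, j)"
  using assms by (subst bcirc_index[of _ m n p]) (auto simp: block_index_less)

text \<open>The first block column of the circulant already lists every slice.\<close>

lemma bcirc_inj:
  assumes A: "A \<in> tensors m n p" and B: "B \<in> tensors m n p" and p: "0 < p"
    and eq: "bcirc A = bcirc B"
  shows "A = B"
proof (rule tensor_eqI[OF A B])
  fix k i j assume "k < p" "i < m" "j < n"
  then show "A ! k $$ (i, j) = B ! k $$ (i, j)"
    using bcirc_block[OF A, of k 0 i j] bcirc_block[OF B, of k 0 i j] eq by simp
qed

lemma bcirc_inv_bcirc:
  assumes "A \<in> tensors m n p" "0 < p"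
  shows "bcirc_inv m n p (bcirc A) = A"
  unfolding bcirc_inv_def
  by (rule the_inv_into_f_f) (auto intro!: inj_onI bcirc_inj assms)

lemma unfold_carrier:
  "B \<in> tensors n s p \<Longrightarrow> 0 < p \<Longrightarrow> unfold_tensor B \<in> carrier_mat (n * p) s"
  by (simp add: unfold_tensor_def Let_def trows_eq tcols_eq tensors_length)

lemma t_prod_tensors:
  assumes "A \<in> tensors m n p" "B \<in> tensors n s p" "0 < p"
  shows "A \<star>\<^sub>T B \<in> tensors m s p"
  using bcirc_carrier[OF assms(1,3)] unfold_carrier[OF assms(2,3)] assms
  by (auto simp: t_prod_def fold_tensor_def tensors_iff trows_eq)

text \<open>Row block \<open>k\<close> of the circulant meets the stacked slices of
  \<open>B\<close>, so the T-product is the cyclic convolution of the two slice sequences.\<close>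

lemma t_prod_nth:
  assumes A: "A \<in> tensors m n p" and B: "B \<in> tensors n s p"
    and k: "k < p" and i: "i < m" and j: "j < s"
  shows "(A \<star>\<^sub>T B) ! k $$ (i, j)
    = (\<Sum>d<p. \<Sum>t<n. A ! ((p + k - d) mod p) $$ (i, t) * B ! d $$ (t, j))"
proof -
  have p: "0 < p" using k by simp
  have ki: "k * m + i < m * p" using k i by (rule block_index_less)
  have "(A \<star>\<^sub>T B) ! k $$ (i, j) = (bcirc A * unfold_tensor B) $$ (k * m + i, j)"
    using A B k i j p unfold_carrier[OF B p]
    by (simp add: t_prod_def fold_tensor_def trows_eq tensors_length)
  also have "\<dots> = (\<Sum>d<p. \<Sum>t<n. bcirc A $$ (k * m + i, d * n + t)
      * unfold_tensor B $$ (d * n + t, j))"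
    using index_mult_block[OF bcirc_carrier[OF A p] unfold_carrier[OF B p] ki j] .
  also have "\<dots> = (\<Sum>d<p. \<Sum>t<n. A ! ((p + k - d) mod p) $$ (i, t) * B ! d $$ (t, j))"
    using k i j B p
    by (intro sum.cong refl) (auto simp: bcirc_block[OF A] unfold_tensor_def Let_def
        trows_eq tcols_eq tensors_length block_index_less)
  finally show ?thesis .
qed

lemma sum_mod_shift:
  fixes g :: "nat \<Rightarrow> 'a::comm_monoid_add"
  assumes "b < p"
  shows "(\<Sum>d<p. g d) = (\<Sum>d<p. g ((p + d - b) mod p))"
  by (rule sum.reindex_bij_witness[of _ "\<lambda>d. (p + d - b) mod p" "\<lambda>d. (d + b) mod p"])
     (use assms in \<open>auto simp: mod_diff_add mod_add_diff\<close>)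

text \<open>After the summation index is shifted by \<open>b\<close>, the convolution at
  \<open>a - b\<close> pairs slice \<open>a - d\<close> of \<open>A\<close> with slice
  \<open>d - b\<close> of \<open>B\<close> (indices modulo \<open>p\<close>), which is block
  \<open>(a, b)\<close> of the matrix product.\<close>

lemma bcirc_prod:
  assumes A: "A \<in> tensors m n p" and B: "B \<in> tensors n s p" and p: "0 < p"
  shows "bcirc (A \<star>\<^sub>T B) = bcirc A * bcirc B"
proof (rule bcirc_eqI[OF t_prod_tensors[OF A B p] p])
  show "bcirc A * bcirc B \<in> carrier_mat (m * p) (s * p)"
    using bcirc_carrier[OF A p] bcirc_carrier[OF B p] by auto
  fix a b i j assume ab: "a < p" "b < p" and ij: "i < m" "j < s"
  let ?c = "(p + a - b) mod p"
  have shift: "(p + ?c - (p + d - b) mod p) mod p = (p + a - d) mod p" if "d < p" for d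
    using that ab by (intro mod_diff_diff)
  have "(A \<star>\<^sub>T B) ! ?c $$ (i, j)
      = (\<Sum>d<p. \<Sum>t<n. A ! ((p + ?c - d) mod p) $$ (i, t) * B ! d $$ (t, j))"
    using ij p by (intro t_prod_nth[OF A B]) auto
  also have "\<dots> = (\<Sum>d<p. \<Sum>t<n. A ! ((p + a - d) mod p) $$ (i, t)
      * B ! ((p + d - b) mod p) $$ (t, j))"
    by (subst sum_mod_shift[OF ab(2)]) (simp add: shift)
  also have "\<dots> = (\<Sum>d<p. \<Sum>t<n. bcirc A $$ (a * m + i, d * n + t)
      * bcirc B $$ (d * n + t, b * s + j))"
    using ab ij by (intro sum.cong refl) (auto simp: bcirc_block[OF A] bcirc_block[OF B])
  also have "\<dots> = (bcirc A * bcirc B) $$ (a * m + i, b * s + j)"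
    using ab ij bcirc_carrier[OF A p] bcirc_carrier[OF B p]
    by (intro index_mult_block[symmetric]) (auto simp: block_index_less)
  finally show "(A \<star>\<^sub>T B) ! ?c $$ (i, j) = (bcirc A * bcirc B) $$ (a * m + i, b * s + j)" .
qed

lemma bcirc_transpose:
  assumes A: "A \<in> tensors m n p" and p: "0 < p"
  shows "bcirc (t_transpose A) = transpose_mat (bcirc A)"
proof (rule bcirc_eqI[OF t_transpose_tensors[OF A] p])
  show "transpose_mat (bcirc A) \<in> carrier_mat (n * p) (m * p)"
    using bcirc_carrier[OF A p] by auto
  fix a b i j assume ab: "a < p" "b < p" and ij: "i < n" "j < m"
  have "(p - (p + a - b) mod p) mod p = (p + b - a) mod p"
    using ab by (intro mod_uminus_diff)
  then show "t_transpose A ! ((p + a - b) mod p) $$ (i, j)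
      = transpose_mat (bcirc A) $$ (a * n + i, b * m + j)"
    using ab ij p bcirc_carrier[OF A p]
    by (simp add: t_transpose_nth[OF A] bcirc_block[OF A] block_index_less)
qed

lemma bcirc_conj:
  assumes A: "A \<in> tensors m n p" and p: "0 < p"
  shows "bcirc (t_conj A) = map_mat cnj (bcirc A)"
  using bcirc_carrier[OF A p] A p
  by (intro bcirc_eqI[OF t_conj_tensors[OF A] p])
     (auto simp: t_conj_nth[OF A] bcirc_block[OF A] block_index_less)

lemma bcirc_uminus:
  assumes A: "A \<in> tensors m n p" and p: "0 < p"
  shows "bcirc (t_uminus A) = - bcirc A"
  using bcirc_carrier[OF A p] A p
  by (intro bcirc_eqI[OF t_uminus_tensors[OF A] p])
     (auto simp: t_uminus_nth[OF A] bcirc_block[OF A] block_index_less)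

lemma bcirc_id:
  assumes p: "0 < p"
  shows "bcirc (t_id n p) = 1\<^sub>m (n * p)"
proof (rule bcirc_eqI[OF t_id_tensors[OF p] p])
  fix a b i j assume ab: "a < p" "b < p" and ij: "i < n" "j < n"
  have "(p + a - b) mod p = 0 \<longleftrightarrow> a = b"
    using ab by (intro mod_diff_eq_0_iff)
  moreover have "a * n + i = b * n + j \<longleftrightarrow> a = b \<and> i = j"
  proof
    assume eq: "a * n + i = b * n + j"
    have "a = (a * n + i) div n" "b = (b * n + j) div n" using ij by auto
    with eq show "a = b \<and> i = j" by auto
  qed simp
  ultimately show "t_id n p ! ((p + a - b) mod p) $$ (i, j)
      = 1\<^sub>m (n * p) $$ (a * n + i, b * n + j)"
    using ab ij p
    by (simp add: t_id_def first_slice_nth[of _ n n] block_index_less)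
qed simp

subsection \<open>The T-algebra\<close>

text \<open>Inherited from matrices, since \<open>bcirc\<close> is injective and multiplicative;
  most product laws below use the same transfer.\<close>

lemma t_prod_assoc:
  assumes A: "A \<in> tensors m n p" and B: "B \<in> tensors n s p" and C: "C \<in> tensors s r p"
    and p: "0 < p"
  shows "A \<star>\<^sub>T B \<star>\<^sub>T C = A \<star>\<^sub>T (B \<star>\<^sub>T C)"
proof (rule bcirc_inj[OF _ _ p])
  show "A \<star>\<^sub>T B \<star>\<^sub>T C \<in> tensors m r p" "A \<star>\<^sub>T (B \<star>\<^sub>T C) \<in> tensors m r p"
    using assms by (blast intro: t_prod_tensors)+
  show "bcirc (A \<star>\<^sub>T B \<star>\<^sub>T C) = bcirc (A \<star>\<^sub>T (B \<star>\<^sub>T C))"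
    using assoc_mult_mat[OF bcirc_carrier[OF A p] bcirc_carrier[OF B p] bcirc_carrier[OF C p]]
    by (simp add: bcirc_prod[OF t_prod_tensors[OF A B p] C p] bcirc_prod[OF A B p]
        bcirc_prod[OF A t_prod_tensors[OF B C p] p] bcirc_prod[OF B C p])
qed

lemma t_id_left:
  assumes A: "A \<in> tensors m n p" and p: "0 < p"
  shows "t_id m p \<star>\<^sub>T A = A"
  using bcirc_carrier[OF A p]
  by (intro bcirc_inj[OF t_prod_tensors[OF t_id_tensors[OF p] A p] A p])
     (simp add: bcirc_prod[OF t_id_tensors[OF p] A p] bcirc_id[OF p])

lemma t_id_right:
  assumes A: "A \<in> tensors m n p" and p: "0 < p"
  shows "A \<star>\<^sub>T t_id n p = A"
  using bcirc_carrier[OF A p]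
  by (intro bcirc_inj[OF t_prod_tensors[OF A t_id_tensors[OF p] p] A p])
     (simp add: bcirc_prod[OF A t_id_tensors[OF p] p] bcirc_id[OF p])

lemma t_transpose_prod:
  assumes A: "A \<in> tensors m n p" and B: "B \<in> tensors n s p" and p: "0 < p"
  shows "t_transpose (A \<star>\<^sub>T B) = t_transpose B \<star>\<^sub>T t_transpose A"
  using transpose_mult[OF bcirc_carrier[OF A p] bcirc_carrier[OF B p]]
  by (intro bcirc_inj[OF t_transpose_tensors[OF t_prod_tensors[OF A B p]]
        t_prod_tensors[OF t_transpose_tensors[OF B] t_transpose_tensors[OF A] p] p])
     (simp add: bcirc_transpose[OF t_prod_tensors[OF A B p] p] bcirc_prod[OF A B p]
        bcirc_prod[OF t_transpose_tensors[OF B] t_transpose_tensors[OF A] p]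
        bcirc_transpose[OF A p] bcirc_transpose[OF B p])

lemma map_mat_cnj_mult:
  assumes "A \<in> carrier_mat m n" "B \<in> carrier_mat n s"
  shows "map_mat cnj (A * B) = map_mat cnj A * map_mat cnj B"
  using assms by (intro eq_matI) (auto simp: scalar_prod_def)

lemma t_conj_prod:
  assumes A: "A \<in> tensors m n p" and B: "B \<in> tensors n s p" and p: "0 < p"
  shows "t_conj (A \<star>\<^sub>T B) = t_conj A \<star>\<^sub>T t_conj B"
  using map_mat_cnj_mult[OF bcirc_carrier[OF A p] bcirc_carrier[OF B p]]
  by (intro bcirc_inj[OF t_conj_tensors[OF t_prod_tensors[OF A B p]]
        t_prod_tensors[OF t_conj_tensors[OF A] t_conj_tensors[OF B] p] p])
     (simp add: bcirc_conj[OF t_prod_tensors[OF A B p] p] bcirc_prod[OF A B p]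
        bcirc_prod[OF t_conj_tensors[OF A] t_conj_tensors[OF B] p]
        bcirc_conj[OF A p] bcirc_conj[OF B p])

lemma t_adjoint_prod:
  assumes A: "A \<in> tensors m n p" and B: "B \<in> tensors n s p" and p: "0 < p"
  shows "t_adjoint (A \<star>\<^sub>T B) = t_adjoint B \<star>\<^sub>T t_adjoint A"
  by (simp add: t_adjoint_eq[OF t_prod_tensors[OF A B p]] t_adjoint_eq[OF A] t_adjoint_eq[OF B]
      t_transpose_prod[OF A B p]
      t_conj_prod[OF t_transpose_tensors[OF B] t_transpose_tensors[OF A] p])

lemma t_uminus_prod_left:
  assumes A: "A \<in> tensors m n p" and B: "B \<in> tensors n s p" and p: "0 < p"
  shows "t_uminus A \<star>\<^sub>T B = t_uminus (A \<star>\<^sub>T B)"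
  using bcirc_carrier[OF A p] bcirc_carrier[OF B p]
  by (intro bcirc_inj[OF t_prod_tensors[OF t_uminus_tensors[OF A] B p]
        t_uminus_tensors[OF t_prod_tensors[OF A B p]] p])
     (simp add: bcirc_prod[OF t_uminus_tensors[OF A] B p] bcirc_uminus[OF A p]
        bcirc_uminus[OF t_prod_tensors[OF A B p] p] bcirc_prod[OF A B p])

lemma t_uminus_prod_right:
  assumes A: "A \<in> tensors m n p" and B: "B \<in> tensors n s p" and p: "0 < p"
  shows "A \<star>\<^sub>T t_uminus B = t_uminus (A \<star>\<^sub>T B)"
  using bcirc_carrier[OF A p] bcirc_carrier[OF B p]
  by (intro bcirc_inj[OF t_prod_tensors[OF A t_uminus_tensors[OF B] p]
        t_uminus_tensors[OF t_prod_tensors[OF A B p]] p])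
     (simp add: bcirc_prod[OF A t_uminus_tensors[OF B] p] bcirc_uminus[OF B p]
        bcirc_uminus[OF t_prod_tensors[OF A B p] p] bcirc_prod[OF A B p])

lemma t_conj_id: "0 < p \<Longrightarrow> t_conj (t_id n p) = t_id n p"
  by (rule tensor_eqI[of _ n n p])
     (auto simp: t_conj_tensors t_id_tensors t_conj_nth[of _ n n p],
      auto simp: t_id_def first_slice_nth[of _ n n])

section \<open>Unitary tensors\<close>

lemma t_unitary_tensors: "t_unitary n p Q \<Longrightarrow> Q \<in> tensors n n p"
  by (simp add: t_unitary_def)

lemma t_unitary_adjoint: "t_unitary n p Q \<Longrightarrow> t_unitary n p (t_adjoint Q)"
  by (simp add: t_unitary_def t_adjoint_tensors t_adjoint_adjoint[of _ n n p])

lemma t_unitary_conj: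
  assumes Q: "t_unitary n p Q" and p: "0 < p"
  shows "t_unitary n p (t_conj Q)"
proof -
  have Q': "Q \<in> tensors n n p" "t_adjoint Q \<in> tensors n n p"
    using Q by (simp_all add: t_unitary_def t_adjoint_tensors)
  have "t_adjoint (t_conj Q) = t_conj (t_adjoint Q)"
    by (simp add: t_adjoint_eq[OF Q'(1)] t_adjoint_eq[OF t_conj_tensors[OF Q'(1)]]
        t_transpose_conj[OF Q'(1)])
  then show ?thesis
    using Q p by (simp add: t_unitary_def t_conj_tensors t_conj_id
        flip: t_conj_prod[OF Q' p] t_conj_prod[OF Q'(2,1) p])
qed

lemma t_unitary_uminus:
  assumes Q: "t_unitary n p Q" and p: "0 < p"
  shows "t_unitary n p (t_uminus Q)"
proof -
  have Q': "Q \<in> tensors n n p" "t_adjoint Q \<in> tensors n n p"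
    using Q by (simp_all add: t_unitary_def t_adjoint_tensors)
  show ?thesis
    using Q p by (simp add: t_unitary_def t_uminus_tensors t_adjoint_uminus[of _ n n p]
        t_uminus_prod_left[OF Q'(1) t_uminus_tensors[OF Q'(2)]]
        t_uminus_prod_left[OF Q'(2) t_uminus_tensors[OF Q'(1)]]
        t_uminus_prod_right[OF Q'] t_uminus_prod_right[OF Q'(2,1)]
        t_uminus_uminus[OF t_id_tensors])
qed

lemma t_unitary_prod:
  assumes P: "t_unitary n p P" and Q: "t_unitary n p Q" and p: "0 < p"
  shows "t_unitary n p (P \<star>\<^sub>T Q)"
proof -
  have t: "P \<in> tensors n n p" "t_adjoint P \<in> tensors n n p"
    "Q \<in> tensors n n p" "t_adjoint Q \<in> tensors n n p"
    using P Q by (simp_all add: t_unitary_def t_adjoint_tensors)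
  \<comment> \<open>One cancellation serves both sides of unitarity: first with
    \<open>X = Q\<close>, \<open>Y = P\<close>, then with the adjoints of \<open>P\<close> and
    \<open>Q\<close>.\<close>
  have c: "t_adjoint X \<star>\<^sub>T t_adjoint Y \<star>\<^sub>T (Y \<star>\<^sub>T X) = t_id n p"
    if X: "X \<in> tensors n n p" "t_adjoint X \<in> tensors n n p" "t_adjoint X \<star>\<^sub>T X = t_id n p"
      and Y: "Y \<in> tensors n n p" "t_adjoint Y \<in> tensors n n p" "t_adjoint Y \<star>\<^sub>T Y = t_id n p" for X Y
  proof -
    have "t_adjoint X \<star>\<^sub>T t_adjoint Y \<star>\<^sub>T (Y \<star>\<^sub>T X) = t_adjoint X \<star>\<^sub>T (t_adjoint Y \<star>\<^sub>T (Y \<star>\<^sub>T X))"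
      by (rule t_prod_assoc[OF X(2) Y(2) t_prod_tensors[OF Y(1) X(1) p] p])
    also have "t_adjoint Y \<star>\<^sub>T (Y \<star>\<^sub>T X) = t_adjoint Y \<star>\<^sub>T Y \<star>\<^sub>T X"
      by (rule t_prod_assoc[OF Y(2) Y(1) X(1) p, symmetric])
    finally show ?thesis by (simp add: X(3) Y(3) t_id_left[OF X(1) p])
  qed
  have a: "t_adjoint (P \<star>\<^sub>T Q) = t_adjoint Q \<star>\<^sub>T t_adjoint P" by (rule t_adjoint_prod[OF t(1,3) p])
  have "t_adjoint (P \<star>\<^sub>T Q) \<star>\<^sub>T (P \<star>\<^sub>T Q) = t_id n p"
    unfolding a using P Q by (intro c t) (auto simp: t_unitary_def)
  moreover have "P \<star>\<^sub>T Q \<star>\<^sub>T t_adjoint (P \<star>\<^sub>T Q) = t_id n p"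
    unfolding a using c[of "t_adjoint P" "t_adjoint Q"] P Q t
    by (simp add: t_adjoint_adjoint[OF t(1)] t_adjoint_adjoint[OF t(3)] t_unitary_def)
  ultimately show ?thesis by (simp add: t_unitary_def t_prod_tensors[OF t(1,3) p])
qed

text \<open>\<open>t_inverse\<close> is a definite description, so uniqueness is required:
  multiplying \<open>Q * X = I\<close> on the left by the adjoint of \<open>Q\<close> already
  determines \<open>X\<close>.\<close>

lemma t_inverse_unitary:
  assumes Q: "t_unitary n p Q" and p: "0 < p"
  shows "t_inverse Q = t_adjoint Q"
proof -
  have Q': "Q \<in> tensors n n p" "t_adjoint Q \<in> tensors n n p"
    using Q by (simp_all add: t_unitary_def t_adjoint_tensors)
  have uniq: "X = t_adjoint Q" if X: "X \<in> tensors n n p" and "Q \<star>\<^sub>T X = t_id n p" for X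
  proof -
    have "X = t_adjoint Q \<star>\<^sub>T Q \<star>\<^sub>T X" using Q X p by (simp add: t_unitary_def t_id_left)
    also have "\<dots> = t_adjoint Q"
      using that p by (simp add: t_prod_assoc[OF Q'(2,1) X p] t_id_right[OF Q'(2)])
    finally show ?thesis .
  qed
  show ?thesis
    unfolding t_inverse_def Let_def trows_eq[OF Q'(1) p] tensors_length[OF Q'(1)]
  proof (rule the_equality)
    show "t_adjoint Q \<in> tensors n n p \<and> Q \<star>\<^sub>T t_adjoint Q = t_id n p \<and> t_adjoint Q \<star>\<^sub>T Q = t_id n p"
      using Q Q' by (simp add: t_unitary_def)
  qed (blast intro: uniq)
qed

section \<open>Tensors supported on the first slice\<close>

lemma first_slice_prod:
  assumes M: "M \<in> carrier_mat m n" and N: "N \<in> carrier_mat n s" and p: "0 < p"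
  shows "first_slice p M \<star>\<^sub>T first_slice p N = first_slice p (M * N)"
proof (rule tensor_eqI)
  note MN = first_slice_tensors[OF M p] first_slice_tensors[OF N p]
  show "first_slice p M \<star>\<^sub>T first_slice p N \<in> tensors m s p" by (rule t_prod_tensors[OF MN p])
  show "first_slice p (M * N) \<in> tensors m s p" using M N p by (intro first_slice_tensors) auto
  fix k i j assume kij: "k < p" "i < m" "j < s"
  \<comment> \<open>In the convolution only \<open>d = 0\<close> contributes, since the other slices
    of the right factor vanish.\<close>
  have "(first_slice p M \<star>\<^sub>T first_slice p N) ! k $$ (i, j)
    = (\<Sum>d<p. if d = 0 then \<Sum>t<n. first_slice p M ! k $$ (i, t) * N $$ (t, j) else 0)"
    unfolding t_prod_nth[OF MN kij]
    using kij by (intro sum.cong refl) (auto simp: first_slice_nth[OF N])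
  also have "\<dots> = first_slice p (M * N) ! k $$ (i, j)"
    using M N kij p
    by (simp add: first_slice_nth[OF M] first_slice_nth[of _ m s] scalar_prod_def lessThan_atLeast0)
  finally show "(first_slice p M \<star>\<^sub>T first_slice p N) ! k $$ (i, j)
    = first_slice p (M * N) ! k $$ (i, j)" .
qed

lemma first_slice_adjoint:
  assumes M: "M \<in> carrier_mat m n" and p: "0 < p"
  shows "t_adjoint (first_slice p M) = first_slice p (mat_adjoint M)"
proof -
  have Ma: "mat_adjoint M \<in> carrier_mat n m" using M by auto
  note t = first_slice_tensors[OF M p]
  have "(p - k) mod p = 0 \<longleftrightarrow> k = 0" if "k < p" for k using that by (cases "k = 0") auto
  then show ?thesis
    using M p unfolding t_adjoint_eq[OF t]
    by (intro tensor_eqI[OF t_conj_tensors[OF t_transpose_tensors[OF t]] first_slice_tensors[OF Ma p]])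
       (auto simp: t_conj_nth[OF t_transpose_tensors[OF t]] t_transpose_nth[OF t]
         first_slice_nth[OF M] first_slice_nth[OF Ma])
qed

lemma mat_adjoint_one: "mat_adjoint (1\<^sub>m n :: complex mat) = 1\<^sub>m n"
  by (intro eq_matI) auto

text \<open>Reduces the unitarity of every listed \<open>T\<close> to a computation with a single
  matrix.\<close>

lemma t_unitary_first_slice:
  assumes M: "M \<in> carrier_mat n n" and p: "0 < p"
    and "mat_adjoint M * M = 1\<^sub>m n" "M * mat_adjoint M = 1\<^sub>m n"
  shows "t_unitary n p (first_slice p M)"
proof -
  have "mat_adjoint M \<in> carrier_mat n n" using M by auto
  then show ?thesis
    using assms by (simp add: t_unitary_def first_slice_tensors first_slice_adjoint
        first_slice_prod[of _ n n] t_id_def)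
qed

subsection \<open>Fourier block diagonalisation\<close>

definition root_unity :: "nat \<Rightarrow> complex" where
  "root_unity p = exp (- 2 * pi * \<i> / of_nat p)"

lemma root_unity_power_self: "0 < p \<Longrightarrow> root_unity p ^ p = 1"
  by (simp add: root_unity_def flip: exp_of_nat_mult) (simp add: exp_minus)

lemma root_unity_cnj: "root_unity p * cnj (root_unity p) = 1"
  by (simp add: root_unity_def flip: complex_norm_square)

text \<open>The \<open>p\<close>-th power of the root is 1 and its conjugate is its inverse, so
  exponents count only modulo \<open>p\<close> and negative exponents become powers of the
  conjugate.\<close>

lemma root_unity_mod_diff:
  assumes "b < p"
  shows "root_unity p ^ ((p + a - b) mod p) = root_unity p ^ a * cnj (root_unity p) ^ b"
proof -
  let ?w = "root_unity p"
  \<comment> \<open>The inserted factor is a power of \<open>?w ^ p = 1\<close>; division with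
    remainder then restores the exponent \<open>p + a - b\<close>.\<close>
  have "?w ^ ((p + a - b) mod p) = ?w ^ ((p + a - b) mod p) * ?w ^ (p * ((p + a - b) div p))"
    using assms by (simp add: power_mult root_unity_power_self)
  also have "\<dots> = ?w ^ (p + a - b)" by (simp flip: power_add)
  also have "\<dots> = ?w ^ (p + a - b) * (?w * cnj ?w) ^ b" by (simp add: root_unity_cnj)
  also have "\<dots> = ?w ^ (p + a - b + b) * cnj ?w ^ b"
    by (simp add: power_mult_distrib power_add mult.assoc)
  also have "\<dots> = ?w ^ a * cnj ?w ^ b"
    using assms by (simp add: power_add root_unity_power_self)
  finally show ?thesis .
qed

lemma root_unity_mod_uminus:
  assumes "c < p"
  shows "root_unity p ^ ((p - c) mod p * k) = cnj (root_unity p) ^ (c * k)"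
  using root_unity_mod_diff[OF assms, of 0] by (simp add: power_mult)

text \<open>The discrete Fourier transform of the block list. The division by \<open>p\<close>
  combines the factors \<open>1 / sqrt p\<close> of the Fourier matrix and of its adjoint, which
  makes this an explicit preimage of \<open>block_circulant\<close> under
  \<open>bcirc\<close>.\<close>

definition dft_tensor :: "nat \<Rightarrow> nat \<Rightarrow> nat \<Rightarrow> complex mat list \<Rightarrow> tensor" where
  "dft_tensor m n p Ds = map (\<lambda>c. mat m n (\<lambda>(i, j).
     (\<Sum>k<p. root_unity p ^ (c * k) * Ds ! k $$ (i, j)) / of_nat p)) [0..<p]"

lemma dft_tensor_tensors: "dft_tensor m n p Ds \<in> tensors m n p"
  by (simp add: dft_tensor_def tensors_iff)

lemma dft_tensor_nth:
  "c < p \<Longrightarrow> i < m \<Longrightarrow> j < n \<Longrightarrow> dft_tensor m n p Ds ! c $$ (i, j)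
    = (\<Sum>k<p. root_unity p ^ (c * k) * Ds ! k $$ (i, j)) / of_nat p"
  by (simp add: dft_tensor_def)

lemma diag_block_mat_carrier:
  "(\<forall>D\<in>set Ds. D \<in> carrier_mat m n) \<Longrightarrow>
    diag_block_mat Ds \<in> carrier_mat (m * length Ds) (n * length Ds)"
  by (induction Ds) (auto simp: Let_def)

lemma index_diag_block_mat:
  assumes "\<forall>D\<in>set Ds. D \<in> carrier_mat m n"
    and "a < length Ds" "b < length Ds" "i < m" "j < n"
  shows "diag_block_mat Ds $$ (a * m + i, b * n + j) = (if a = b then Ds ! a $$ (i, j) else 0)"
  using assms
proof (induction Ds arbitrary: a b)
  case (Cons D Ds)
  have D: "D \<in> carrier_mat m n" and Ds: "\<forall>D\<in>set Ds. D \<in> carrier_mat m n"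
    using Cons.prems(1) by auto
  note c = diag_block_mat_carrier[OF Ds]
  have "a * m + i < m + m * length Ds" "b * n + j < n + n * length Ds"
    using block_index_less[OF Cons.prems(2,4)] block_index_less[OF Cons.prems(3,5)] by auto
  then show ?case
    using D c Cons.prems Cons.IH[OF Ds]
    by (cases a; cases b) (auto simp: Let_def block_index_less)
qed simp

lemma kronecker_one_carrier:
  "A \<in> carrier_mat p q \<Longrightarrow> A \<otimes>\<^sub>K 1\<^sub>m m \<in> carrier_mat (m * p) (m * q)"
  by (auto simp: kronecker_def)

lemma index_kronecker_one:
  assumes "A \<in> carrier_mat p q" "a < p" "b < q" "i < m" "j < m"
  shows "(A \<otimes>\<^sub>K 1\<^sub>m m) $$ (a * m + i, b * m + j) = (if i = j then A $$ (a, b) else 0)"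
  using assms block_index_less[of a p i m] block_index_less[of b q j m]
  by (auto simp: kronecker_def mult.commute)

lemma fourier_mat_carrier: "fourier_mat p \<in> carrier_mat p p"
  by (simp add: fourier_mat_def)

lemma index_fourier_mat:
  "a < p \<Longrightarrow> b < p \<Longrightarrow> fourier_mat p $$ (a, b) = root_unity p ^ (a * b) / of_real (sqrt (real p))"
  by (simp add: fourier_mat_def root_unity_def)

lemma fourier_mat_mult_cnj:
  assumes "a < p" "b < p" "d < p"
  shows "fourier_mat p $$ (a, d) * cnj (fourier_mat p $$ (b, d))
    = root_unity p ^ ((p + a - b) mod p * d) / of_nat p"
proof -
  have "complex_of_real (sqrt (real p)) * complex_of_real (sqrt (real p)) = of_nat p"
    by (simp flip: of_real_mult)
  then show ?thesis
    using assms by (simp add: index_fourier_mat power_mult root_unity_mod_diff power_mult_distrib)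
qed

text \<open>Block \<open>(a, b)\<close> of the triple product is the sum over \<open>d\<close> of
  \<open>F(a,d) * cnj F(b,d)\<close> times block \<open>d\<close> of the list. These coefficients
  depend only on \<open>a - b\<close> modulo \<open>p\<close>, so the matrix is block
  circulant.\<close>

lemma bcirc_dft_tensor:
  assumes len: "length Ds = p" and Ds: "\<forall>D\<in>set Ds. D \<in> carrier_mat m n" and p: "0 < p"
  shows "bcirc (dft_tensor m n p Ds) = block_circulant m n p Ds"
proof (rule bcirc_eqI[OF dft_tensor_tensors p])
  let ?F = "fourier_mat p" and ?L = "fourier_mat p \<otimes>\<^sub>K 1\<^sub>m m"
    and ?D = "diag_block_mat Ds" and ?R = "mat_adjoint (fourier_mat p) \<otimes>\<^sub>K 1\<^sub>m n"
  have L: "?L \<in> carrier_mat (m * p) (m * p)"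
    by (rule kronecker_one_carrier[OF fourier_mat_carrier])
  have Fa: "mat_adjoint ?F \<in> carrier_mat p p" using fourier_mat_carrier[of p] by auto
  have R: "?R \<in> carrier_mat (n * p) (n * p)" by (rule kronecker_one_carrier[OF Fa])
  have D: "?D \<in> carrier_mat (m * p) (n * p)" using diag_block_mat_carrier[OF Ds] len by simp
  have LD: "?L * ?D \<in> carrier_mat (m * p) (n * p)" using L D by auto
  show "block_circulant m n p Ds \<in> carrier_mat (m * p) (n * p)"
    using LD R by (auto simp: block_circulant_def)
  fix a b i j assume ab: "a < p" "b < p" and ij: "i < m" "j < n"
  \<comment> \<open>The Kronecker factor couples only equal offsets and the diagonal factor only
    equal blocks, so a single term of the double sum survives.\<close>
  have inner: "(?L * ?D) $$ (a * m + i, d * n + t) = ?F $$ (a, d) * Ds ! d $$ (i, t)"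
    if dt: "d < p" "t < n" for d t
  proof -
    have "(?L * ?D) $$ (a * m + i, d * n + t)
      = (\<Sum>e<p. \<Sum>s<m. ?L $$ (a * m + i, e * m + s) * ?D $$ (e * m + s, d * n + t))"
      using ab ij dt by (intro index_mult_block[OF L D]) (auto simp: block_index_less)
    also have "\<dots> = (\<Sum>e<p. if e = d then
        \<Sum>s<m. if s = i then ?F $$ (a, d) * Ds ! d $$ (i, t) else 0 else 0)"
    proof (rule sum.cong[OF refl])
      fix e assume "e \<in> {..<p}"
      then show "(\<Sum>s<m. ?L $$ (a * m + i, e * m + s) * ?D $$ (e * m + s, d * n + t))
        = (if e = d then \<Sum>s<m. if s = i then ?F $$ (a, d) * Ds ! d $$ (i, t) else 0 else 0)"
        using ab ij dt len
        by (cases "e = d") (auto simp: index_kronecker_one[OF fourier_mat_carrier]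
            index_diag_block_mat[OF Ds] simp del: sum.delta intro!: sum.cong sum.neutral)
    qed
    finally show ?thesis using ij dt by simp
  qed
  have "block_circulant m n p Ds $$ (a * m + i, b * n + j)
    = (\<Sum>d<p. \<Sum>t<n. (?L * ?D) $$ (a * m + i, d * n + t) * ?R $$ (d * n + t, b * n + j))"
    unfolding block_circulant_def
    using ab ij by (intro index_mult_block[OF LD R]) (auto simp: block_index_less)
  also have "\<dots> = (\<Sum>d<p. \<Sum>t<n. if t = j then
      ?F $$ (a, d) * cnj (?F $$ (b, d)) * Ds ! d $$ (i, j) else 0)"
    using ab ij fourier_mat_carrier[of p]
    by (intro sum.cong refl) (auto simp: inner index_kronecker_one[OF Fa])
  also have "\<dots> = (\<Sum>d<p. root_unity p ^ ((p + a - b) mod p * d) / of_nat p * Ds ! d $$ (i, j))"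
    using ab ij by (intro sum.cong refl) (simp add: fourier_mat_mult_cnj)
  also have "\<dots> = dft_tensor m n p Ds ! ((p + a - b) mod p) $$ (i, j)"
    using ij p by (simp add: dft_tensor_nth sum_divide_distrib)
  finally show "dft_tensor m n p Ds ! ((p + a - b) mod p) $$ (i, j)
    = block_circulant m n p Ds $$ (a * m + i, b * n + j)" ..
qed

section \<open>Negation of frequencies\<close>

lemma sum_mod_uminus:
  fixes g :: "nat \<Rightarrow> 'a::comm_monoid_add"
  shows "(\<Sum>k<p. g ((p - k) mod p)) = (\<Sum>k<p. g k)"
proof -
  have inv: "(p - (p - k) mod p) mod p = k" if "k < p" for k
    using that by (cases "k = 0") auto
  show ?thesis
    by (rule sum.reindex_bij_witness[of _ "\<lambda>k. (p - k) mod p" "\<lambda>k. (p - k) mod p"])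
       (auto simp: inv)
qed

text \<open>The block list indexed by the negated frequency modulo \<open>p\<close>; block 0 stays
  in place.\<close>

definition reverse_blocks :: "nat \<Rightarrow> 'a list \<Rightarrow> 'a list" where
  "reverse_blocks p Ds = map (\<lambda>k. Ds ! ((p - k) mod p)) [0..<p]"

lemma reverse_blocks_map:
  assumes "length Ds = p"
  shows "map g (reverse_blocks p Ds) = reverse_blocks p (map g Ds)"
  using assms by (auto simp: reverse_blocks_def)

lemma reverse_blocks_length: "length (reverse_blocks p Ds) = p"
  by (simp add: reverse_blocks_def)

lemma reverse_blocks_set:
  assumes "length Ds = p"
  shows "set (reverse_blocks p Ds) \<subseteq> set Ds"
proof
  fix D assume "D \<in> set (reverse_blocks p Ds)"
  then obtain k where "k < p" "D = Ds ! ((p - k) mod p)" by (auto simp: reverse_blocks_def)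
  then show "D \<in> set Ds" using assms by simp
qed

text \<open>Conjugating the Fourier matrix replaces the frequency \<open>k\<close> by \<open>-k\<close>, so transposition and
  conjugation reverse the order of the Fourier blocks, while the adjoint keeps it.\<close>

lemma dft_tensor_transpose:
  assumes len: "length Ds = p" and Ds: "\<forall>D\<in>set Ds. D \<in> carrier_mat m n"
  shows "t_transpose (dft_tensor m n p Ds)
    = dft_tensor n m p (reverse_blocks p (map transpose_mat Ds))"
proof (rule tensor_eqI[OF t_transpose_tensors[OF dft_tensor_tensors] dft_tensor_tensors])
  fix c i j assume cij: "c < p" "i < n" "j < m"
  have "t_transpose (dft_tensor m n p Ds) ! c $$ (i, j)
    = (\<Sum>k<p. root_unity p ^ ((p - c) mod p * k) * Ds ! k $$ (j, i)) / of_nat p"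
    using cij by (simp add: t_transpose_nth[OF dft_tensor_tensors] dft_tensor_nth)
  \<comment> \<open>Both powers equal the conjugate root to the power \<open>c * k\<close>: the
    minus sign moves from the slice index to the frequency, and the sum can then be
    reindexed.\<close>
  also have "(\<Sum>k<p. root_unity p ^ ((p - c) mod p * k) * Ds ! k $$ (j, i))
    = (\<Sum>k<p. root_unity p ^ (c * ((p - k) mod p)) * Ds ! k $$ (j, i))"
    using root_unity_mod_uminus[OF cij(1)] root_unity_mod_uminus[of _ p c]
    by (intro sum.cong refl) (simp add: mult.commute)
  also have "\<dots> = (\<Sum>k<p. root_unity p ^ (c * ((p - ((p - k) mod p)) mod p))
      * Ds ! ((p - k) mod p) $$ (j, i))"
    by (rule sum_mod_uminus[symmetric])
  also have "\<dots> = (\<Sum>k<p. root_unity p ^ (c * k)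
      * reverse_blocks p (map transpose_mat Ds) ! k $$ (i, j))"
  proof (rule sum.cong[OF refl])
    fix k assume "k \<in> {..<p}"
    then have k: "k < p" "(p - ((p - k) mod p)) mod p = k" by (cases "k = 0"; auto)+
    then have "Ds ! ((p - k) mod p) \<in> carrier_mat m n" using Ds len by auto
    with k cij len show "root_unity p ^ (c * ((p - ((p - k) mod p)) mod p))
        * Ds ! ((p - k) mod p) $$ (j, i)
      = root_unity p ^ (c * k) * reverse_blocks p (map transpose_mat Ds) ! k $$ (i, j)"
      by (simp add: reverse_blocks_def)
  qed
  finally show "t_transpose (dft_tensor m n p Ds) ! c $$ (i, j)
    = dft_tensor n m p (reverse_blocks p (map transpose_mat Ds)) ! c $$ (i, j)"
    using cij by (simp add: dft_tensor_nth)
qed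

lemma dft_tensor_conj:
  assumes len: "length Ds = p" and Ds: "\<forall>D\<in>set Ds. D \<in> carrier_mat m n"
  shows "t_conj (dft_tensor m n p Ds) = dft_tensor m n p (reverse_blocks p (map (map_mat cnj) Ds))"
proof (rule tensor_eqI[OF t_conj_tensors[OF dft_tensor_tensors] dft_tensor_tensors])
  fix c i j assume cij: "c < p" "i < m" "j < n"
  have "t_conj (dft_tensor m n p Ds) ! c $$ (i, j)
    = (\<Sum>k<p. cnj (root_unity p) ^ (c * k) * cnj (Ds ! k $$ (i, j))) / of_nat p"
    using cij by (simp add: t_conj_nth[OF dft_tensor_tensors] dft_tensor_nth)
  also have "(\<Sum>k<p. cnj (root_unity p) ^ (c * k) * cnj (Ds ! k $$ (i, j)))
    = (\<Sum>k<p. root_unity p ^ (c * ((p - k) mod p)) * cnj (Ds ! k $$ (i, j)))"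
    using root_unity_mod_uminus[of _ p c]
    by (intro sum.cong refl) (simp add: mult.commute)
  also have "\<dots> = (\<Sum>k<p. root_unity p ^ (c * ((p - ((p - k) mod p)) mod p))
      * cnj (Ds ! ((p - k) mod p) $$ (i, j)))"
    by (rule sum_mod_uminus[symmetric])
  also have "\<dots> = (\<Sum>k<p. root_unity p ^ (c * k)
      * reverse_blocks p (map (map_mat cnj) Ds) ! k $$ (i, j))"
  proof (rule sum.cong[OF refl])
    fix k assume "k \<in> {..<p}"
    then have k: "k < p" "(p - ((p - k) mod p)) mod p = k" by (cases "k = 0"; auto)+
    then have "Ds ! ((p - k) mod p) \<in> carrier_mat m n" using Ds len by auto
    with k cij len show "root_unity p ^ (c * ((p - ((p - k) mod p)) mod p))
        * cnj (Ds ! ((p - k) mod p) $$ (i, j))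
      = root_unity p ^ (c * k) * reverse_blocks p (map (map_mat cnj) Ds) ! k $$ (i, j)"
      by (simp add: reverse_blocks_def)
  qed
  finally show "t_conj (dft_tensor m n p Ds) ! c $$ (i, j)
    = dft_tensor m n p (reverse_blocks p (map (map_mat cnj) Ds)) ! c $$ (i, j)"
    using cij by (simp add: dft_tensor_nth)
qed

subsection \<open>Generalized tensor functions\<close>

text \<open>The clause of \<open>t_svd\<close> on \<open>Sig\<close>, isolated because it must be
  preserved when blocks are transposed and reordered.\<close>

definition singular_blocks :: "nat \<Rightarrow> nat \<Rightarrow> nat \<Rightarrow> real mat list \<Rightarrow> bool" where
  "singular_blocks m n p Sig \<longleftrightarrow> length Sig = p \<and>
     (\<forall>D \<in> set Sig. D \<in> carrier_mat m n \<and> diagonal_mat D \<and> (\<forall>x \<in> elements_mat D. 0 \<le> x))"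

lemma singular_blocks_reverse:
  "singular_blocks m n p Sig \<Longrightarrow> singular_blocks m n p (reverse_blocks p Sig)"
  using reverse_blocks_set[of Sig p]
  by (auto simp: singular_blocks_def reverse_blocks_length)

lemma singular_blocks_transpose:
  assumes "singular_blocks m n p Sig"
  shows "singular_blocks n m p (map transpose_mat Sig)"
proof -
  have "elements_mat (transpose_mat D) = elements_mat D" for D :: "real mat"
    unfolding elements_mat_def by auto
  then show ?thesis
    using assms by (auto simp: singular_blocks_def diagonal_mat_def)
qed

lemma F_diagonal_dft_tensor:
  assumes "length Ds = p" "\<forall>D\<in>set Ds. D \<in> carrier_mat m n \<and> diagonal_mat D"
  shows "F_diagonal (dft_tensor m n p Ds)"
proof -
  have "Ds ! k $$ (i, j) = 0" if "k < p" "i < m" "j < n" "i \<noteq> j" for k i j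
    using that assms nth_mem[of k Ds] unfolding diagonal_mat_def by (metis carrier_matD)
  then show ?thesis by (auto simp: F_diagonal_def dft_tensor_def diagonal_mat_def)
qed

text \<open>Injectivity of \<open>bcirc\<close> determines the middle factor as a Fourier transform
  of \<open>Sig\<close>, and its F-diagonality follows from the diagonal blocks.\<close>

lemma t_svd_iff:
  assumes A: "A \<in> tensors m n p" and p: "0 < p"
  shows "t_svd A U S V Sig \<longleftrightarrow> t_unitary m p U \<and> t_unitary n p V \<and> singular_blocks m n p Sig \<and>
    S = dft_tensor m n p (map (map_mat complex_of_real) Sig) \<and> A = U \<star>\<^sub>T S \<star>\<^sub>T t_adjoint V"
proof -
  let ?Ds = "map (map_mat complex_of_real) Sig"
  have dft: "bcirc (dft_tensor m n p ?Ds) = block_circulant m n p ?Ds"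
      "F_diagonal (dft_tensor m n p ?Ds)"
    if "singular_blocks m n p Sig"
    using that p
    by (auto simp: singular_blocks_def diagonal_mat_def
        intro!: bcirc_dft_tensor F_diagonal_dft_tensor)
  have "S = dft_tensor m n p ?Ds"
    if "singular_blocks m n p Sig" "S \<in> tensors m n p" "bcirc S = block_circulant m n p ?Ds"
    using bcirc_inj[OF that(2) dft_tensor_tensors p] dft(1)[OF that(1)] that(3) by simp
  then show ?thesis
    unfolding t_svd_def Let_def trows_eq[OF A p] tcols_eq[OF A p] tensors_length[OF A]
      singular_blocks_def[symmetric]
    using dft dft_tensor_tensors[of m n p ?Ds] by (auto simp: singular_blocks_def)
qed

lemma f_tilde_carrier: "D \<in> carrier_mat m n \<Longrightarrow> f_tilde f D \<in> carrier_mat m n"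
  by (simp add: f_tilde_def)

text \<open>The argument of \<open>bcirc_inv\<close> lies in the image of \<open>bcirc\<close>,
  where the inverse has its intended value.\<close>

lemma f_hat_eq:
  assumes "singular_blocks m n p Sig" "0 < p"
  shows "f_hat f m n p Sig = dft_tensor m n p (map (f_tilde f) Sig)"
proof -
  have "bcirc (dft_tensor m n p (map (f_tilde f) Sig))
      = block_circulant m n p (map (f_tilde f) Sig)"
    using assms by (intro bcirc_dft_tensor) (auto simp: singular_blocks_def f_tilde_carrier)
  then show ?thesis
    using bcirc_inv_bcirc[OF dft_tensor_tensors assms(2)] by (metis f_hat_def)
qed

text \<open>\<open>A\<close> and \<open>B\<close> have the same outer factors and the same
  \<open>Sig\<close>, and differ only in the function applied to the blocks. One identity for a
  generic middle factor therefore transports both.\<close>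

lemma gtf_value_iff:
  assumes A: "A \<in> tensors m n p" and p: "0 < p"
  shows "gtf_value f A B \<longleftrightarrow> (\<exists>U V Sig. t_unitary m p U \<and> t_unitary n p V \<and>
    singular_blocks m n p Sig \<and>
    A = U \<star>\<^sub>T dft_tensor m n p (map (map_mat complex_of_real) Sig) \<star>\<^sub>T t_adjoint V \<and>
    B = U \<star>\<^sub>T dft_tensor m n p (map (f_tilde f) Sig) \<star>\<^sub>T t_adjoint V)"
  (is "_ \<longleftrightarrow> ?R")
proof
  assume "gtf_value f A B"
  then show ?R
    unfolding gtf_value_def t_svd_iff[OF A p] trows_eq[OF A p] tcols_eq[OF A p] tensors_length[OF A]
    using f_hat_eq[OF _ p] by metis
next
  assume ?R
  then obtain U V Sig where *: "t_unitary m p U" "t_unitary n p V" "singular_blocks m n p Sig"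
    "A = U \<star>\<^sub>T dft_tensor m n p (map (map_mat complex_of_real) Sig) \<star>\<^sub>T t_adjoint V"
    "B = U \<star>\<^sub>T dft_tensor m n p (map (f_tilde f) Sig) \<star>\<^sub>T t_adjoint V"
    by blast
  have "t_svd A U (dft_tensor m n p (map (map_mat complex_of_real) Sig)) V Sig"
    unfolding t_svd_iff[OF A p] using * by blast
  moreover have "B = U \<star>\<^sub>T f_hat f m n p Sig \<star>\<^sub>T t_adjoint V"
    using * f_hat_eq[OF _ p] by metis
  ultimately show "gtf_value f A B"
    unfolding gtf_value_def trows_eq[OF A p] tcols_eq[OF A p] tensors_length[OF A] by blast
qed

lemma gtf_value_tensors:
  assumes A: "A \<in> tensors m n p" and p: "0 < p" and "gtf_value f A B"
  shows "B \<in> tensors m n p"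
  using assms unfolding gtf_value_iff[OF A p]
  by (blast intro: t_prod_tensors dft_tensor_tensors t_adjoint_tensors t_unitary_tensors)

section \<open>Symmetries of function values\<close>

lemma gtf_value_unitary_equiv:
  assumes A: "A \<in> tensors m n p" and p: "0 < p" and f: "gtf_value f A B"
    and P: "t_unitary m p P" and Q: "t_unitary n p Q"
  shows "gtf_value f (P \<star>\<^sub>T A \<star>\<^sub>T t_adjoint Q) (P \<star>\<^sub>T B \<star>\<^sub>T t_adjoint Q)"
proof -
  have P': "P \<in> tensors m m p" and Q': "Q \<in> tensors n n p" "t_adjoint Q \<in> tensors n n p"
    using P Q by (auto simp: t_unitary_tensors t_adjoint_tensors)
  obtain U V Sig where UV: "t_unitary m p U" "t_unitary n p V" and Sig: "singular_blocks m n p Sig"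
    and A_eq: "A = U \<star>\<^sub>T dft_tensor m n p (map (map_mat complex_of_real) Sig) \<star>\<^sub>T t_adjoint V"
    and B_eq: "B = U \<star>\<^sub>T dft_tensor m n p (map (f_tilde f) Sig) \<star>\<^sub>T t_adjoint V"
    using f unfolding gtf_value_iff[OF A p] by blast
  have U': "U \<in> tensors m m p" and V': "V \<in> tensors n n p" "t_adjoint V \<in> tensors n n p"
    using UV by (auto simp: t_unitary_tensors t_adjoint_tensors)
  \<comment> \<open>The outer factors become \<open>P * U\<close> and \<open>Q * V\<close>, while
    \<open>Sig\<close> stays fixed.\<close>
  have move: "P \<star>\<^sub>T (U \<star>\<^sub>T X \<star>\<^sub>T t_adjoint V) \<star>\<^sub>T t_adjoint Q
      = P \<star>\<^sub>T U \<star>\<^sub>T X \<star>\<^sub>T t_adjoint (Q \<star>\<^sub>T V)" if X: "X \<in> tensors m n p" for X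
  proof -
    note UX = t_prod_tensors[OF U' X p]
    have "P \<star>\<^sub>T U \<star>\<^sub>T X \<star>\<^sub>T t_adjoint (Q \<star>\<^sub>T V)
        = P \<star>\<^sub>T (U \<star>\<^sub>T X) \<star>\<^sub>T (t_adjoint V \<star>\<^sub>T t_adjoint Q)"
      by (simp only: t_adjoint_prod[OF Q'(1) V'(1) p] t_prod_assoc[OF P' U' X p])
    also have "\<dots> = P \<star>\<^sub>T (U \<star>\<^sub>T X) \<star>\<^sub>T t_adjoint V \<star>\<^sub>T t_adjoint Q"
      by (rule t_prod_assoc[OF t_prod_tensors[OF P' UX p] V'(2) Q'(2) p, symmetric])
    also have "P \<star>\<^sub>T (U \<star>\<^sub>T X) \<star>\<^sub>T t_adjoint V = P \<star>\<^sub>T (U \<star>\<^sub>T X \<star>\<^sub>T t_adjoint V)"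
      by (rule t_prod_assoc[OF P' UX V'(2) p])
    finally show ?thesis ..
  qed
  have "P \<star>\<^sub>T A \<star>\<^sub>T t_adjoint Q \<in> tensors m n p"
    by (rule t_prod_tensors[OF t_prod_tensors[OF P' A p] Q'(2) p])
  then show ?thesis
    unfolding gtf_value_iff[OF \<open>P \<star>\<^sub>T A \<star>\<^sub>T t_adjoint Q \<in> tensors m n p\<close> p]
    using t_unitary_prod[OF P UV(1) p] t_unitary_prod[OF Q UV(2) p] Sig A_eq B_eq
      move[OF dft_tensor_tensors] by blast
qed

text \<open>Negation is the unitary equivalence by \<open>-I\<close> on the left and
  \<open>I\<close> on the right: the sign goes into the left factor, and the singular values do not
  change.\<close>

lemma gtf_value_uminus:
  assumes A: "A \<in> tensors m n p" and p: "0 < p" and f: "gtf_value f A B"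
  shows "gtf_value f (t_uminus A) (t_uminus B)"
proof -
  have I: "t_unitary n p (t_id n p)" for n
    using t_unitary_first_slice[OF one_carrier_mat p]
    by (simp add: t_id_def mat_adjoint_one)
  note neg = t_unitary_uminus[OF I p]
  have "t_uminus (t_id m p) \<star>\<^sub>T X \<star>\<^sub>T t_adjoint (t_id n p) = t_uminus X" if X: "X \<in> tensors m n p" for X
  proof -
    have "t_adjoint (t_id n p) = t_id n p"
      using I[of n] t_id_right[OF t_adjoint_tensors[OF t_id_tensors[OF p]] p]
      by (simp add: t_unitary_def)
    then show ?thesis
      by (simp add: t_uminus_prod_left[OF t_id_tensors[OF p] X p] t_id_left[OF X p]
          t_id_right[OF t_uminus_tensors[OF X] p])
  qed
  then show ?thesis
    using gtf_value_unitary_equiv[OF A p f neg I] A gtf_value_tensors[OF A p f] by simp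
qed

text \<open>Transposing \<open>U * S * V^H\<close> gives a T-SVD whose outer factors are the
  conjugates of \<open>V\<close> and \<open>U\<close>. The blocks are transposed and
  frequency-reversed, and \<open>f_tilde\<close> commutes with both changes.\<close>

lemma gtf_value_transpose:
  assumes A: "A \<in> tensors m n p" and p: "0 < p" and f: "gtf_value f A B"
  shows "gtf_value f (t_transpose A) (t_transpose B)"
proof -
  obtain U V Sig where UV: "t_unitary m p U" "t_unitary n p V" and Sig: "singular_blocks m n p Sig"
    and A_eq: "A = U \<star>\<^sub>T dft_tensor m n p (map (map_mat complex_of_real) Sig) \<star>\<^sub>T t_adjoint V"
    and B_eq: "B = U \<star>\<^sub>T dft_tensor m n p (map (f_tilde f) Sig) \<star>\<^sub>T t_adjoint V"
    using f unfolding gtf_value_iff[OF A p] by blast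
  have U': "U \<in> tensors m m p" and V': "V \<in> tensors n n p" "t_adjoint V \<in> tensors n n p"
    using UV by (auto simp: t_unitary_tensors t_adjoint_tensors)
  have transpose: "t_transpose (U \<star>\<^sub>T X \<star>\<^sub>T t_adjoint V)
      = t_conj V \<star>\<^sub>T t_transpose X \<star>\<^sub>T t_adjoint (t_conj U)" if X: "X \<in> tensors m n p" for X
  proof -
    have "t_transpose (t_adjoint V) = t_conj V"
      using t_transpose_conj[OF t_transpose_tensors[OF V'(1)]]
      by (simp add: t_adjoint_eq[OF V'(1)] t_transpose_transpose[OF V'(1)])
    moreover have "t_adjoint (t_conj U) = t_transpose U"
      by (simp add: t_adjoint_eq[OF t_conj_tensors[OF U']] t_transpose_conj[OF U']
          t_conj_conj[OF t_transpose_tensors[OF U']])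
    ultimately show ?thesis
      using t_prod_assoc[OF t_conj_tensors[OF V'(1)] t_transpose_tensors[OF X]
          t_transpose_tensors[OF U'] p]
      by (simp add: t_transpose_prod[OF t_prod_tensors[OF U' X p] V'(2) p]
          t_transpose_prod[OF U' X p])
  qed
  let ?Sig = "reverse_blocks p (map transpose_mat Sig)"
  have blocks: "t_transpose (dft_tensor m n p (map g Sig)) = dft_tensor n m p (map g ?Sig)"
    if "\<And>D. D \<in> carrier_mat m n \<Longrightarrow> diagonal_mat D \<Longrightarrow> g D \<in> carrier_mat m n"
      "\<And>D. D \<in> carrier_mat m n \<Longrightarrow> transpose_mat (g D) = g (transpose_mat D)" for g
    using that Sig
    by (auto simp: dft_tensor_transpose singular_blocks_def reverse_blocks_map
        intro!: arg_cong[where f = "\<lambda>x. dft_tensor n m p (reverse_blocks p x)"])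
  have "transpose_mat (f_tilde f D) = f_tilde f (transpose_mat D)" for D
    by (intro eq_matI) (auto simp: f_tilde_def)
  moreover have "transpose_mat (map_mat complex_of_real D) = map_mat complex_of_real (transpose_mat D)"
    for D by (intro eq_matI) auto
  ultimately show ?thesis
    unfolding gtf_value_iff[OF t_transpose_tensors[OF A] p]
    using t_unitary_conj[OF UV(1) p] t_unitary_conj[OF UV(2) p]
      singular_blocks_reverse[OF singular_blocks_transpose[OF Sig]]
      transpose[OF dft_tensor_tensors] blocks[of "f_tilde f"] blocks[of "map_mat complex_of_real"]
    by (intro exI[of _ "t_conj V"] exI[of _ "t_conj U"] exI[of _ ?Sig])
       (simp add: A_eq B_eq f_tilde_carrier)
qed

text \<open>The outer factors are conjugated and the block order is reversed. The singular values
  are real, so conjugation affects only the values of \<open>f\<close>.\<close>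

lemma gtf_value_conj:
  assumes A: "A \<in> tensors m n p" and p: "0 < p" and f: "gtf_value f A B"
  shows "gtf_value (\<lambda>z. cnj (f z)) (t_conj A) (t_conj B)"
proof -
  let ?g = "\<lambda>z. cnj (f z)"
  obtain U V Sig where UV: "t_unitary m p U" "t_unitary n p V" and Sig: "singular_blocks m n p Sig"
    and A_eq: "A = U \<star>\<^sub>T dft_tensor m n p (map (map_mat complex_of_real) Sig) \<star>\<^sub>T t_adjoint V"
    and B_eq: "B = U \<star>\<^sub>T dft_tensor m n p (map (f_tilde f) Sig) \<star>\<^sub>T t_adjoint V"
    using f unfolding gtf_value_iff[OF A p] by blast
  have U': "U \<in> tensors m m p" and V': "V \<in> tensors n n p" "t_adjoint V \<in> tensors n n p"
    using UV by (auto simp: t_unitary_tensors t_adjoint_tensors)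
  have conj: "t_conj (U \<star>\<^sub>T X \<star>\<^sub>T t_adjoint V)
      = t_conj U \<star>\<^sub>T t_conj X \<star>\<^sub>T t_adjoint (t_conj V)" if X: "X \<in> tensors m n p" for X
  proof -
    have "t_adjoint (t_conj V) = t_conj (t_adjoint V)"
      by (simp add: t_adjoint_eq[OF t_conj_tensors[OF V'(1)]] t_adjoint_eq[OF V'(1)]
          t_transpose_conj[OF V'(1)])
    then show ?thesis
      by (simp add: t_conj_prod[OF t_prod_tensors[OF U' X p] V'(2) p] t_conj_prod[OF U' X p])
  qed
  let ?Sig = "reverse_blocks p Sig"
  have blocks: "t_conj (dft_tensor m n p (map g Sig)) = dft_tensor m n p (map h ?Sig)"
    if "\<And>D. D \<in> carrier_mat m n \<Longrightarrow> g D \<in> carrier_mat m n"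
      "\<And>D. map_mat cnj (g D) = h D" for g h
    using that Sig by (simp add: dft_tensor_conj singular_blocks_def reverse_blocks_map o_def)
  have "map_mat cnj (f_tilde f D) = f_tilde ?g D" for D
    by (intro eq_matI) (auto simp: f_tilde_def)
  moreover have "map_mat cnj (map_mat complex_of_real D) = map_mat complex_of_real D" for D
    by (intro eq_matI) auto
  ultimately show ?thesis
    unfolding gtf_value_iff[OF t_conj_tensors[OF A] p]
    using t_unitary_conj[OF UV(1) p] t_unitary_conj[OF UV(2) p] singular_blocks_reverse[OF Sig]
      conj[OF dft_tensor_tensors] blocks[of "f_tilde f" "f_tilde ?g"]
      blocks[of "map_mat complex_of_real" "map_mat complex_of_real"]
    by (intro exI[of _ "t_conj U"] exI[of _ "t_conj V"] exI[of _ ?Sig])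
       (simp add: A_eq B_eq f_tilde_carrier)
qed

text \<open>\<open>f_tilde\<close> evaluates \<open>f\<close> only at positive entries, all of which
  are positive singular values. This allows \<open>f\<close> to be exchanged for its conjugate where
  its values are real.\<close>

lemma gtf_value_cong:
  assumes "\<And>\<sigma>. \<sigma> \<in> pos_singular_values A \<Longrightarrow> f (complex_of_real \<sigma>) = g (complex_of_real \<sigma>)"
    and f: "gtf_value f A B"
  shows "gtf_value g A B"
proof -
  obtain U S V Sig where svd: "t_svd A U S V Sig"
    and B: "B = U \<star>\<^sub>T f_hat f (trows A) (tcols A) (length A) Sig \<star>\<^sub>T t_adjoint V"
    using f by (auto simp: gtf_value_def)
  have "f_tilde f D = f_tilde g D" if D: "D \<in> set Sig" for D
  proof (rule eq_matI)
    fix i j assume "i < dim_row (f_tilde g D)" "j < dim_col (f_tilde g D)"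
    then have ij: "i < dim_row D" "j < dim_col D" by (simp_all add: f_tilde_def)
    have "D $$ (i, j) \<in> elements_mat D" using ij by auto
    then have "f (D $$ (i, j)) = g (D $$ (i, j))" if "0 < D $$ (i, j)"
      using svd D that by (intro assms(1)) (unfold pos_singular_values_def, blast)
    then show "f_tilde f D $$ (i, j) = f_tilde g D $$ (i, j)"
      using ij by (auto simp: f_tilde_def)
  qed (simp_all add: f_tilde_def)
  then have "map (f_tilde f) Sig = map (f_tilde g) Sig" by simp
  then show ?thesis using svd B unfolding gtf_value_def f_hat_def by metis
qed

subsection \<open>The listed scalar product spaces\<close>

lemma mat_adjoint_zero: "mat_adjoint (0\<^sub>m m n :: complex mat) = 0\<^sub>m n m"
  by (intro eq_matI) auto

lemma uminus_zero_mat: "- 0\<^sub>m m n = (0\<^sub>m m n :: complex mat)"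
  by (intro eq_matI) auto

lemma mat_adjoint_uminus: "mat_adjoint (- M :: complex mat) = - mat_adjoint M"
  by (intro eq_matI) auto

lemma mat_adjoint_four_block:
  fixes A B C D :: "complex mat"
  assumes "A \<in> carrier_mat m1 n1" "B \<in> carrier_mat m1 n2"
    "C \<in> carrier_mat m2 n1" "D \<in> carrier_mat m2 n2"
  shows "mat_adjoint (four_block_mat A B C D)
    = four_block_mat (mat_adjoint A) (mat_adjoint C) (mat_adjoint B) (mat_adjoint D)"
  using assms by (intro eq_matI) auto

lemma t_zero_eq: "0 < p \<Longrightarrow> t_zero m n p = first_slice p (0\<^sub>m m n)"
  by (cases p) (simp_all add: t_zero_def first_slice_def)

lemma t_uminus_first_slice: "t_uminus (first_slice p M) = first_slice p (- M)"
  by (simp add: t_uminus_def first_slice_def uminus_zero_mat)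

lemma t_block_first_slice:
  assumes "A \<in> carrier_mat m1 n1" "B \<in> carrier_mat m1 n2"
    "C \<in> carrier_mat m2 n1" "D \<in> carrier_mat m2 n2" and "0 < p"
  shows "t_block (first_slice p A) (first_slice p B) (first_slice p C) (first_slice p D)
    = first_slice p (four_block_mat A B C D)"
  using assms
  by (intro nth_equalityI) (auto simp: t_block_def first_slice_def nth_Cons split: nat.splits)

lemma J_tensor_unitary:
  assumes p: "0 < p"
  shows "t_unitary (2 * n) p (J_tensor n p)"
proof -
  let ?J = "four_block_mat (0\<^sub>m n n) (1\<^sub>m n) (- 1\<^sub>m n) (0\<^sub>m n n) :: complex mat"
  \<comment> \<open>This is \<open>-?J\<close>, which is also the adjoint of \<open>?J\<close>, in
    block form ready for multiplication.\<close>
  let ?J' = "four_block_mat (0\<^sub>m n n) (- 1\<^sub>m n) (1\<^sub>m n) (0\<^sub>m n n) :: complex mat"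
  have "J_tensor n p = first_slice p ?J"
    using p by (simp add: J_tensor_def t_id_def t_zero_eq t_uminus_first_slice
        t_block_first_slice[of _ n n _ n _ n])
  moreover have J': "mat_adjoint ?J = ?J'"
    by (simp add: mat_adjoint_four_block[of _ n n _ n _ n] mat_adjoint_zero mat_adjoint_one
        mat_adjoint_uminus)
  moreover have "?J * ?J' = 1\<^sub>m (2 * n)" "?J' * ?J = 1\<^sub>m (2 * n)"
    by (simp_all add: mult_four_block_mat[of _ n n _ n _ n _ _ n _ n] mult_2 uminus_zero_mat)
  moreover have "?J \<in> carrier_mat (2 * n) (2 * n)" by (simp add: mult_2)
  ultimately show ?thesis using p by (simp add: t_unitary_first_slice)
qed

lemma Sigma_tensor_unitary:
  assumes p: "0 < p"
  shows "t_unitary (a + b) p (Sigma_tensor a b p)"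
proof -
  let ?S = "four_block_mat (1\<^sub>m a) (0\<^sub>m a b) (0\<^sub>m b a) (- 1\<^sub>m b) :: complex mat"
  have "Sigma_tensor a b p = first_slice p ?S"
    using p by (simp add: Sigma_tensor_def t_id_def t_zero_eq t_uminus_first_slice
        t_block_first_slice[of _ a a _ b _ b])
  moreover have "mat_adjoint ?S = ?S"
    by (simp add: mat_adjoint_four_block[of _ a a _ b _ b] mat_adjoint_zero mat_adjoint_one
        mat_adjoint_uminus)
  moreover have "?S * ?S = 1\<^sub>m (a + b)"
    by (simp add: mult_four_block_mat[of _ a a _ b _ b _ _ a _ b] uminus_zero_mat)
  ultimately show ?thesis using p by (simp add: t_unitary_first_slice)
qed

lemma R_tensor_unitary:
  assumes p: "0 < p"
  shows "t_unitary n p (R_tensor n p)"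
proof -
  let ?R = "mat n n (\<lambda>(i, j). if i + j + 1 = n then 1 else 0) :: complex mat"
  have "mat_adjoint ?R = ?R" by (intro eq_matI) auto
  moreover have "?R * ?R = 1\<^sub>m n"
  proof (rule eq_matI)
    fix i j assume "i < dim_row (1\<^sub>m n :: complex mat)" "j < dim_col (1\<^sub>m n :: complex mat)"
    then have ij: "i < n" "j < n" by simp_all
    then have "(?R * ?R) $$ (i, j)
      = (\<Sum>t<n. (if i + t + 1 = n then 1 else 0) * (if t + j + 1 = n then 1 else 0))"
      by (simp add: scalar_prod_def lessThan_atLeast0)
    \<comment> \<open>The first factor leaves only \<open>t = n - 1 - i\<close>; the second then
      requires \<open>i = j\<close>.\<close>
    also have "\<dots> = (\<Sum>t<n. if t = n - 1 - i then if i = j then 1 else 0 else 0)"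
      using ij by (intro sum.cong refl) auto
    finally show "(?R * ?R) $$ (i, j) = 1\<^sub>m n $$ (i, j)" using ij by simp
  qed auto
  ultimately show ?thesis using p by (simp add: t_unitary_first_slice R_tensor_def)
qed

text \<open>All that the main argument takes from the list of spaces.\<close>

lemma listed_space_unitary:
  assumes "listed_space K form N p T"
  shows "0 < p" "t_unitary N p T" "K = \<real> \<or> K = UNIV"
proof -
  have "0 < p \<and> t_unitary N p T \<and> (K = \<real> \<or> K = UNIV)"
    using assms
  proof induction
  qed (auto simp: J_tensor_unitary Sigma_tensor_unitary R_tensor_unitary t_id_def mat_adjoint_one
      intro!: t_unitary_first_slice)
  then show "0 < p" "t_unitary N p T" "K = \<real> \<or> K = UNIV" by auto
qed

text \<open>Realness as a fixed-point condition, so that it can be derived from uniqueness of the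
  function value.\<close>

lemma tensor_over_Reals_iff: "A \<in> tensor_over \<real> m n p \<longleftrightarrow> A \<in> tensors m n p \<and> t_conj A = A"
proof -
  have "elements_mat X \<subseteq> \<real> \<longleftrightarrow> map_mat cnj X = X" for X :: "complex mat"
  proof
    assume "elements_mat X \<subseteq> \<real>"
    then have "X $$ (i, j) \<in> \<real>" if "i < dim_row X" "j < dim_col X" for i j
      using that by (auto intro: elements_matI)
    then show "map_mat cnj X = X" by (intro eq_matI) (auto simp: Reals_cnj_iff)
  next
    assume eq: "map_mat cnj X = X"
    show "elements_mat X \<subseteq> \<real>"
    proof
      fix x assume "x \<in> elements_mat X"
      then obtain i j where ij: "i < dim_row X" "j < dim_col X" and x: "x = X $$ (i, j)"
        by blast
      then have "cnj x = map_mat cnj X $$ (i, j)" by simp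
      then show "x \<in> \<real>" using eq x by (simp add: Reals_cnj_iff)
    qed
  qed
  moreover have "t_conj A = A \<longleftrightarrow> (\<forall>X\<in>set A. map_mat cnj X = X)"
    unfolding t_conj_def by (induction A) auto
  ultimately show ?thesis by (auto simp: tensor_over_def)
qed

text \<open>For unitary \<open>T\<close> the inverse is the adjoint, so the star is a unitary
  equivalence applied to the transpose or adjoint of \<open>A\<close>.\<close>

lemma gtf_value_t_star:
  assumes A: "A \<in> tensors N N p" and p: "0 < p" and T: "t_unitary N p T" and f: "gtf_value f A B"
    and real: "form = Sesquilinear \<Longrightarrow> \<forall>\<sigma>\<in>pos_singular_values A. f (complex_of_real \<sigma>) \<in> \<real>"
  shows "gtf_value f (t_star form T A) (t_star form T B)"
proof -
  have B: "B \<in> tensors N N p" by (rule gtf_value_tensors[OF A p f])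
  note equiv = gtf_value_unitary_equiv[OF _ p _ t_unitary_adjoint[OF T] t_unitary_adjoint[OF T]]
  note T_simps = t_inverse_unitary[OF T p] t_adjoint_adjoint[OF t_unitary_tensors[OF T]]
  show ?thesis
  proof (cases form)
    case Bilinear
    then show ?thesis
      using equiv[OF t_transpose_tensors[OF A] gtf_value_transpose[OF A p f]] by (simp add: T_simps)
  next
    case Sesquilinear
    \<comment> \<open>Passing to the conjugate of \<open>f\<close> beforehand compensates for the
      conjugation in the adjoint, which then restores \<open>f\<close>.\<close>
    then have "gtf_value (\<lambda>z. cnj (f z)) A B"
      using real by (intro gtf_value_cong[OF _ f]) (auto simp: Reals_cnj_iff)
    then have "gtf_value (\<lambda>z. cnj (f z)) (t_transpose A) (t_transpose B)"
      by (rule gtf_value_transpose[OF A p])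
    from gtf_value_conj[OF t_transpose_tensors[OF A] p this]
    have "gtf_value f (t_adjoint A) (t_adjoint B)" by (simp add: t_adjoint_eq[OF A] t_adjoint_eq[OF B])
    then show ?thesis
      using Sesquilinear equiv[OF t_adjoint_tensors[OF A]] by (simp add: T_simps)
  qed
qed

text \<open>The realness hypothesis, absent from the English statement, excludes genuine
  counterexamples: for \<open>f\<close> constantly \<open>\<i>\<close> and \<open>A = T = I\<close>,
  the value is \<open>\<i>\<close> times the identity, which is neither real nor
  self-adjoint.\<close>

theorem theorem8:
  fixes f :: "complex \<Rightarrow> complex"
    and K :: "complex set" and form :: form_type and N p :: nat
    and T A :: tensor and \<T> :: "tensor set"
  assumes "listed_space K form N p T"
    and "\<T> = jordan_algebra K form N p T \<or> \<T> = lie_algebra K form N p T"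
    and "A \<in> \<T>"
    and "gtf_well_defined f A"
    and "K = \<real> \<or> form = Sesquilinear \<Longrightarrow>
      \<forall>\<sigma> \<in> pos_singular_values A. f (complex_of_real \<sigma>) \<in> \<real>"
  shows "gtf f A \<in> \<T>"
proof -
  note p = listed_space_unitary(1)[OF assms(1)]
  note T = listed_space_unitary(2)[OF assms(1)]
  have A_over: "A \<in> tensor_over K N N p"
    using assms(2,3) by (auto simp: jordan_algebra_def lie_algebra_def)
  then have A: "A \<in> tensors N N p" by (auto simp: tensor_over_def)
  have uniq: "X = Y" if "gtf_value f A X" "gtf_value f A Y" for X Y
    using that assms(4) unfolding gtf_well_defined_def by blast
  have f: "gtf_value f A (gtf f A)"
    using theI'[OF assms(4)[unfolded gtf_well_defined_def]] by (simp add: gtf_def)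
  have B: "gtf f A \<in> tensors N N p" by (rule gtf_value_tensors[OF A p f])
  have B_over: "gtf f A \<in> tensor_over K N N p"
  proof (cases "K = \<real>")
    case True
    \<comment> \<open>Read as a value of the conjugate of \<open>f\<close>, the tensor becomes under
      conjugation a value of \<open>f\<close> itself at the real tensor \<open>A\<close>.\<close>
    then have "gtf_value (\<lambda>z. cnj (f z)) A (gtf f A)"
      using assms(5) by (intro gtf_value_cong[OF _ f]) (auto simp: Reals_cnj_iff)
    from gtf_value_conj[OF A p this] have "gtf_value f A (t_conj (gtf f A))"
      using A_over True by (simp add: tensor_over_Reals_iff)
    from uniq[OF this f] show ?thesis using True B by (simp add: tensor_over_Reals_iff)
  qed (use B listed_space_unitary(3)[OF assms(1)] in auto)
  have star: "gtf_value f (t_star form T A) (t_star form T (gtf f A))"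
    using assms(5) by (intro gtf_value_t_star[OF A p T f]) auto
  from assms(2) show ?thesis
  proof
    assume \<T>: "\<T> = jordan_algebra K form N p T"
    then have "t_star form T A = A" using assms(3) by (simp add: jordan_algebra_def)
    with star have "gtf_value f A (t_star form T (gtf f A))" by simp
    from uniq[OF this f] show ?thesis using \<T> B_over by (simp add: jordan_algebra_def)
  next
    assume \<T>: "\<T> = lie_algebra K form N p T"
    then have "t_star form T A = t_uminus A" using assms(3) by (simp add: lie_algebra_def)
    with star have neg: "gtf_value f (t_uminus A) (t_star form T (gtf f A))" by simp
    note nA = t_uminus_tensors[OF A]
    \<comment> \<open>Negating a value at \<open>-A\<close> returns to \<open>A\<close>, where
      uniqueness applies.\<close>
    have "gtf_value f A (t_uminus (t_star form T (gtf f A)))"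
      using gtf_value_uminus[OF nA p neg] by (simp add: t_uminus_uminus[OF A])
    from uniq[OF this f] have "t_star form T (gtf f A) = t_uminus (gtf f A)"
      using t_uminus_uminus[OF gtf_value_tensors[OF nA p neg]] by metis
    then show ?thesis using \<T> B_over by (simp add: lie_algebra_def)
  qed
qed

end
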